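(* Let $\chi_1,\chi_2$ be primitive Dirichlet characters of conductors $q_1,q_2$ respectively, with $q_1,q_2>1$ and $\chi_1\chi_2(-1)=1$. Let $\gamma=\begin{pmatrix} a & b\\ c & d\end{pmatrix}\in\Gamma_0(q_1q_2)$ with $c\ge 1$. Then \[ S_{\chi_1,\chi_2}(\gamma)=\sum_{j \bmod c}\ \sum_{n \bmod q_1}\overline{\chi_2}(j)\,\overline{\chi_1}(n)\,B_1\!\Big(\frac{j}{c}\Big)\,B_1\!\Big(\frac{n}{q_1}+\frac{aj}{c}\Big). \]
   Context: Write $e(x)=\exp(2\pi i x)$, $\mathbb{H}$ for the upper half-plane, and $\tau(\chi)=\sum_{n \bmod q}\chi(n)e(n/q)$ for the Gauss sum of a character $\chi$ modulo $q$. Set $\psi=\chi_1\overline{\chi_2}$ and, for $\gamma=\begin{pmatrix} a & b\\ c & d\end{pmatrix}\in\Gamma_0(q_1q_2)$, $\psi(\gamma)=\psi(d)$. For $n\ge1$ let $\lambda_{\chi_1,\chi_2}(n,1)=\chi_2(1)\sum_{ab=n}\chi_1(a)\overline{\chi_2}(b)(b/a)^{1/2}$, and define the holomorphic function on $\mathbb{H}$ \[ f_{\chi_1,\chi_2}(z)=\sum_{n=1}^\infty \frac{\lambda_{\chi_1,\chi_2}(n,1)}{\sqrt n}e(nz)=\sum_{k\ge1}\sum_{l\ge1}\frac{\chi_1(l)\overline{\chi_2}(k)}{l}e(klz). \] For $\gamma\in\Gamma_0(q_1q_2)$, the quantity $\phi_{\chi_1,\chi_2}(\gamma)=f_{\chi_1,\chi_2}(\gamma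 z)-\psi(\gamma)f_{\chi_1,\chi_2}(z)$ is independent of $z\in\mathbb{H}$, and the Dedekind sum is $S_{\chi_1,\chi_2}(\gamma)=\frac{\tau(\overline{\chi_1})}{\pi i}\phi_{\chi_1,\chi_2}(\gamma)$. The first Bernoulli function is $B_1(x)=x-\lfloor x\rfloor-\tfrac12$ for $x\in\mathbb{R}\setminus\mathbb{Z}$ and $B_1(x)=0$ for $x\in\mathbb{Z}$. *)

theory Defs
  imports "HOL-Complex_Analysis.Complex_Analysis"
begin

text \<open>
  Dirichlet characters modulo \<open>q\<close>, as functions on the integers extended by \<open>0\<close> to the
  arguments that are not coprime to \<open>q\<close>. Multiplicativity and \<open>chi 1 \<noteq> 0\<close> force \<open>chi 1 = 1\<close>.
\<close>

definition dirichlet_character :: "nat \<Rightarrow> (int \<Rightarrow> complex) \<Rightarrow> bool" where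
  "dirichlet_character q chi \<longleftrightarrow> q > 0 \<and>
     (\<forall>n. chi (n + int q) = chi n) \<and>
     (\<forall>m n. chi (m * n) = chi m * chi n) \<and>
     (\<forall>n. chi n \<noteq> 0 \<longleftrightarrow> coprime n (int q))"

definition conductor :: "nat \<Rightarrow> (int \<Rightarrow> complex) \<Rightarrow> nat" where
  "conductor q chi = (LEAST d. d dvd q \<and>
     (\<exists>chi'. dirichlet_character d chi' \<and> (\<forall>n. coprime n (int q) \<longrightarrow> chi n = chi' n)))"

definition primitive_character :: "nat \<Rightarrow> (int \<Rightarrow> complex) \<Rightarrow> bool" where
  "primitive_character q chi \<longleftrightarrow> dirichlet_character q chi \<and> conductor q chi = q"

definition exp_2pii :: "complex \<Rightarrow> complex" where
  "exp_2pii x = exp (2 * of_real pi * \<i> * x)"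

definition gauss_sum :: "nat \<Rightarrow> (int \<Rightarrow> complex) \<Rightarrow> complex" where
  "gauss_sum q chi = (\<Sum>n\<in>{0..<int q}. chi n * exp_2pii (of_int n / of_nat q))"

definition upper_half_plane :: "complex set" where
  "upper_half_plane = {z. Im z > 0}"

definition Gamma0 :: "nat \<Rightarrow> (int^2^2) set" where
  "Gamma0 N = {\<gamma>. det \<gamma> = 1 \<and> int N dvd \<gamma> $ 2 $ 1}"

definition moebius_action :: "int^2^2 \<Rightarrow> complex \<Rightarrow> complex" where
  "moebius_action \<gamma> z =
     (of_int (\<gamma> $ 1 $ 1) * z + of_int (\<gamma> $ 1 $ 2)) / (of_int (\<gamma> $ 2 $ 1) * z + of_int (\<gamma> $ 2 $ 2))"

text \<open>The coefficient \<open>\<lambda>(n,1)\<close>, for \<open>n \<ge> 1\<close>.\<close>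

definition eisenstein_coeff :: "(int \<Rightarrow> complex) \<Rightarrow> (int \<Rightarrow> complex) \<Rightarrow> nat \<Rightarrow> complex" where
  "eisenstein_coeff chi1 chi2 n =
     chi2 1 * (\<Sum>(a, b)\<in>{(a, b). a * b = n}.
       chi1 (int a) * cnj (chi2 (int b)) * of_real (sqrt (real b / real a)))"

definition eisenstein_f :: "(int \<Rightarrow> complex) \<Rightarrow> (int \<Rightarrow> complex) \<Rightarrow> complex \<Rightarrow> complex" where
  "eisenstein_f chi1 chi2 z =
     (\<Sum>n. eisenstein_coeff chi1 chi2 (Suc n) / of_real (sqrt (real (Suc n)))
             * exp_2pii (of_nat (Suc n) * z))"

definition nebentypus :: "(int \<Rightarrow> complex) \<Rightarrow> (int \<Rightarrow> complex) \<Rightarrow> int^2^2 \<Rightarrow> complex" where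
  "nebentypus chi1 chi2 \<gamma> = chi1 (\<gamma> $ 2 $ 2) * cnj (chi2 (\<gamma> $ 2 $ 2))"

text \<open>
  \<open>\<phi>(\<gamma>)\<close> is the common value, over all \<open>z\<close> in the upper half-plane, of \<open>f(\<gamma>z) - \<psi>(\<gamma>) f(z)\<close>.
\<close>

definition dedekind_phi :: "(int \<Rightarrow> complex) \<Rightarrow> (int \<Rightarrow> complex) \<Rightarrow> int^2^2 \<Rightarrow> complex" where
  "dedekind_phi chi1 chi2 \<gamma> =
     (THE w. \<forall>z\<in>upper_half_plane.
        eisenstein_f chi1 chi2 (moebius_action \<gamma> z) - nebentypus chi1 chi2 \<gamma> * eisenstein_f chi1 chi2 z = w)"

text \<open>The parameter \<open>q1\<close> is the modulus of \<open>chi1\<close>, needed for the Gauss sum.\<close>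

definition dedekind_sum ::
  "nat \<Rightarrow> (int \<Rightarrow> complex) \<Rightarrow> (int \<Rightarrow> complex) \<Rightarrow> int^2^2 \<Rightarrow> complex" where
  "dedekind_sum q1 chi1 chi2 \<gamma> =
     gauss_sum q1 (\<lambda>n. cnj (chi1 n)) / (of_real pi * \<i>) * dedekind_phi chi1 chi2 \<gamma>"

definition bernoulli_B1 :: "real \<Rightarrow> real" where
  "bernoulli_B1 x = (if x \<in> \<int> then 0 else x - of_int \<lfloor>x\<rfloor> - 1 / 2)"

end

theory Submission
  imports Defs "HOL-Number_Theory.Cong"
begin

text \<open>
  The proof is a direct one by contour integration and uses no modular forms. With
  \<open>K y u = exp (y u) / (1 - exp u)\<close>, integrate \<open>K x (2 \<pi> \<i> w) K y (- 2 \<pi> t w) / w\<close> over growing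
  rectangles. The residues at the nonzero poles give, for \<open>0 < x, y < 1\<close>, two Lambert series, one in
  \<open>t\<close> and one in \<open>1 / t\<close>; the triple pole at \<open>0\<close> contributes \<open>(x - 1/2) (y - 1/2)\<close> plus terms
  depending only on \<open>x\<close> or only on \<open>y\<close>. Put \<open>y = j / c\<close>, let \<open>x\<close> be the fractional part of
  \<open>n / q1 + a j / c\<close>, and sum over \<open>j\<close> and \<open>n\<close> against the conjugates of \<open>chi2 j\<close> and \<open>chi1 n\<close>.
  By the Gauss sum identity for the primitive character \<open>chi1\<close>, the two Lambert series become \<open>f\<close>
  at \<open>(a + \<i> t) / c\<close> and \<open>\<psi>(\<gamma>)\<close> times \<open>f\<close> at \<open>(- d + \<i> / t) / c\<close>; the former point is the image
  of the latter under \<open>\<gamma>\<close>. The terms in one variable cancel, since \<open>chi1\<close> sums to \<open>0\<close>. This is the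
  formula on the line \<open>Re z = - d / c\<close>, and the identity theorem extends it to the upper half-plane.
\<close>

section \<open>Contour integration of the Bernoulli kernels\<close>

text \<open>\<open>- u * bernoulli_kernel y u\<close> is the generating function u exp (y u) / (exp
  u - 1) of the Bernoulli polynomials in y. For \<open>Re u < 0\<close> the kernel is also the sum
  of exp ((y + n) u) over n >= 0, which is how Lambert series arise from it. At a pole its value is
  0, by division by zero.\<close>

definition bernoulli_kernel :: "real \<Rightarrow> complex \<Rightarrow> complex" where
  "bernoulli_kernel y u = exp (of_real y * u) / (1 - exp u)"

text \<open>Multiply numerator and denominator by \<open>exp u\<close>; at a pole both sides are 0.
  This reflection moves arguments from the right half-plane to the left one.\<close>

lemma bernoulli_kernel_minus: "bernoulli_kernel y (-u) = - bernoulli_kernel (1 - y) u"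
proof (cases "exp u = 1")
  case True
  then show ?thesis by (simp add: bernoulli_kernel_def exp_minus)
next
  case False
  then have "1 - inverse (exp u) \<noteq> 0" "1 - exp u \<noteq> 0" by auto
  then show ?thesis
    by (simp add: bernoulli_kernel_def exp_minus exp_diff ring_distribs field_simps)
qed

lemma bernoulli_kernel_holomorphic [holomorphic_intros]:
  assumes "f holomorphic_on S" "\<And>w. w \<in> S \<Longrightarrow> exp (f w) \<noteq> 1"
  shows "(\<lambda>w. bernoulli_kernel y (f w)) holomorphic_on S"
  unfolding bernoulli_kernel_def
  by (intro holomorphic_intros assms) (use assms(2) in auto)

text \<open>When \<open>exp u\<close> is a negative real, that is, \<open>Im u\<close> is an odd
  multiple of \<pi>, the denominator is 1 + exp (Re u). For y in [0, 1] it dominates exp (y Re u),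
  whatever the sign of \<open>Re u\<close>.\<close>

lemma norm_bernoulli_kernel_le_1:
  assumes "0 \<le> y" "y \<le> 1" "exp u = - of_real (exp (Re u))"
  shows "norm (bernoulli_kernel y u) \<le> 1"
proof -
  have "1 - exp u = of_real (1 + exp (Re u))"
    using assms(3) by simp
  then have "norm (1 - exp u) = 1 + exp (Re u)"
    by (simp only: norm_of_real) (simp add: add_nonneg_nonneg)
  moreover have "norm (exp (of_real y * u)) \<le> 1 + exp (Re u)"
  proof (cases "Re u \<le> 0")
    case True
    then have "exp (y * Re u) \<le> 1" using assms by (simp add: mult_nonneg_nonpos)
    then show ?thesis by (simp add: add_increasing2)
  next
    case False
    then have "y * Re u \<le> 1 * Re u" using assms by (intro mult_right_mono) auto
    then have "exp (y * Re u) \<le> exp (Re u)" by simp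
    then have "exp (y * Re u) \<le> 1 + exp (Re u)" by linarith
    then show ?thesis by simp
  qed
  moreover have "0 < 1 + exp (Re u)" by (simp add: add_pos_pos)
  ultimately show ?thesis
    by (simp add: bernoulli_kernel_def norm_divide divide_le_eq)
qed

text \<open>Here the denominator has norm at least 1 - 1/e \<ge> 1/2, whence the factor 2.\<close>

lemma norm_bernoulli_kernel_le_neg:
  assumes "Re u \<le> -1"
  shows "norm (bernoulli_kernel y u) \<le> 2 * exp (y * Re u)"
proof -
  have "exp (Re u) \<le> exp (-1)" using assms by simp
  also have "exp (-1::real) \<le> 1/2"
    using exp_ge_add_one_self[of "1::real"] by (simp add: exp_minus field_simps)
  finally have "1/2 \<le> norm (1 - exp u)"
    using norm_triangle_ineq2[of 1 "exp u"] by simp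
  then have "exp (y * Re u) * 1 \<le> exp (y * Re u) * (2 * norm (1 - exp u))"
    by (intro mult_left_mono) auto
  moreover have "0 < norm (1 - exp u)" using \<open>1/2 \<le> norm (1 - exp u)\<close> by linarith
  ultimately show ?thesis
    by (simp add: bernoulli_kernel_def norm_divide divide_le_eq mult_ac)
qed

text \<open>On the left the rate is y, on the right, after reflection, 1 - y. The minimum of the two
  is positive exactly when 0 < y < 1.\<close>

lemma norm_bernoulli_kernel_decay:
  assumes "1 \<le> \<bar>Re u\<bar>"
  shows "norm (bernoulli_kernel y u) \<le> 2 * exp (- min y (1 - y) * \<bar>Re u\<bar>)"
proof (cases "Re u \<le> 0")
  case True
  have "norm (bernoulli_kernel y u) \<le> 2 * exp (y * Re u)"
    using assms True by (intro norm_bernoulli_kernel_le_neg) auto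
  also have "y * Re u \<le> min y (1 - y) * Re u"
    using True by (intro mult_right_mono_neg) auto
  finally show ?thesis using True by simp
next
  case False
  have "norm (bernoulli_kernel y u) = norm (bernoulli_kernel (1 - y) (-u))"
    using bernoulli_kernel_minus[of y "-u"] by simp
  also have "\<dots> \<le> 2 * exp ((1 - y) * - Re u)"
    using norm_bernoulli_kernel_le_neg[of "-u" "1 - y"] False assms by simp
  also have "(1 - y) * - Re u \<le> min y (1 - y) * - Re u"
    using False by (intro mult_right_mono_neg) auto
  finally show ?thesis using False by simp
qed

text \<open>The factor w removes the simple pole at 0, leaving the value -1/\<alpha>. The series is
  a quotient by that of (1 - exp (\<alpha> w)) / w, and comparing coefficients of degree 0 and 1 in
  \<open>G * D\<close> gives the two values; the second is the Bernoulli polynomial y - 1/2 up to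
  sign.\<close>

lemma bernoulli_kernel_expansion:
  fixes \<alpha> :: complex and y :: real
  assumes "\<alpha> \<noteq> 0"
  defines "G \<equiv> fps_exp (of_real y * \<alpha>) * inverse (fps_shift 1 (1 - fps_exp \<alpha>))"
  shows "(\<lambda>w. if w = 0 then - 1 / \<alpha> else w * bernoulli_kernel y (\<alpha> * w)) has_fps_expansion G"
    and "fps_nth G 0 = - 1 / \<alpha>" and "fps_nth G 1 = - of_real (y - 1/2)"
proof -
  define D where "D = fps_shift 1 (1 - fps_exp \<alpha>)"
  have D0: "fps_nth D 0 = - \<alpha>" and D1: "fps_nth D 1 = - \<alpha>\<^sup>2 / 2"
    by (simp_all add: D_def power2_eq_square)
  have ne: "fps_nth D 0 \<noteq> 0" using D0 assms by simp
  have "fps_nth (1 - fps_exp \<alpha>) 1 \<noteq> 0" using assms by simp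
  moreover have "fps_nth (1 - fps_exp \<alpha>) 0 = 0" by simp
  ultimately have "subdegree (1 - fps_exp \<alpha>) = 1"
    by (intro subdegreeI) (auto simp: less_Suc_eq)
  then have "(\<lambda>w. if w = 0 then - \<alpha> else (1 - exp (\<alpha> * w)) / w ^ 1) has_fps_expansion D"
    unfolding D_def by (intro has_fps_expansion_shift fps_expansion_intros) auto
  then have "(\<lambda>w. exp ((of_real y * \<alpha>) * w) * inverse (if w = 0 then - \<alpha> else (1 - exp (\<alpha> * w)) / w ^ 1))
      has_fps_expansion G"
    unfolding G_def D_def[symmetric] using ne by (intro fps_expansion_intros)
  also have "(\<lambda>w. exp ((of_real y * \<alpha>) * w) * inverse (if w = 0 then - \<alpha> else (1 - exp (\<alpha> * w)) / w ^ 1))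
    = (\<lambda>w. if w = 0 then - 1 / \<alpha> else w * bernoulli_kernel y (\<alpha> * w))"
    by (auto simp: fun_eq_iff bernoulli_kernel_def field_simps)
  finally show "(\<lambda>w. if w = 0 then - 1 / \<alpha> else w * bernoulli_kernel y (\<alpha> * w)) has_fps_expansion G" .
  have GD: "G * D = fps_exp (of_real y * \<alpha>)"
    using inverse_mult_eq_1[OF ne] by (simp only: G_def D_def[symmetric] mult.assoc mult_1_right)
  have "fps_nth G 0 * fps_nth D 0 = 1"
    using arg_cong[OF GD, of "\<lambda>H. fps_nth H 0"] by simp
  then show G0: "fps_nth G 0 = - 1 / \<alpha>" using D0 assms by (simp add: field_simps)
  have "fps_nth G 0 * fps_nth D 1 + fps_nth G 1 * fps_nth D 0 = of_real y * \<alpha>"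
    using arg_cong[OF GD, of "\<lambda>H. fps_nth H 1"] by (simp add: fps_mult_nth_1)
  then have "(- 1 / \<alpha>) * (- \<alpha>\<^sup>2 / 2) + fps_nth G 1 * (- \<alpha>) = of_real y * \<alpha>"
    unfolding G0 D0 D1 .
  moreover have "(- 1 / \<alpha>) * (- \<alpha>\<^sup>2 / 2) = \<alpha> / 2"
    using assms(1) by (simp add: power2_eq_square)
  ultimately have "\<alpha> * fps_nth G 1 = \<alpha> * (- of_real (y - 1/2))"
    by (simp add: algebra_simps)
  then show "fps_nth G 1 = - of_real (y - 1/2)" using assms(1) by simp
qed

text \<open>The residue is the degree 2 coefficient of the product of the two expansions. The middle
  product is (x - 1/2) (y - 1/2). Each outer product contains a constant coefficient, free of x and
  y, and so depends on one variable only. These terms stay unspecified as \<open>g\<close> and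
  \<open>h\<close>, because the character sums remove them.\<close>

lemma residue_bernoulli_kernels_at_0:
  fixes \<alpha> \<beta> :: complex
  assumes "\<alpha> \<noteq> 0" "\<beta> \<noteq> 0"
  obtains g h :: "real \<Rightarrow> complex" where
    "\<And>x y. residue (\<lambda>w. bernoulli_kernel x (\<alpha> * w) * bernoulli_kernel y (\<beta> * w) / w) 0
       = of_real ((x - 1/2) * (y - 1/2)) + g x + h y"
proof
  fix x y :: real
  define G where "G \<gamma> y = fps_exp (of_real y * \<gamma>) * inverse (fps_shift 1 (1 - fps_exp \<gamma>))"
    for \<gamma> :: complex and y :: real
  define p where "p \<gamma> y w = (if w = 0 then - 1 / \<gamma> else w * bernoulli_kernel y (\<gamma> * w))"
    for \<gamma> y w
  note e1 = bernoulli_kernel_expansion[OF assms(1), of x, folded G_def p_def]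
  note e2 = bernoulli_kernel_expansion[OF assms(2), of y, folded G_def p_def]
  have "residue (\<lambda>w. bernoulli_kernel x (\<alpha> * w) * bernoulli_kernel y (\<beta> * w) / w) 0 =
      residue (\<lambda>w. (p \<alpha> x w * p \<beta> y w) / w ^ Suc 2) 0"
    by (intro residue_cong) (auto simp: p_def eventually_at_filter power_numeral_reduce)
  also have "\<dots> = fps_nth (G \<alpha> x * G \<beta> y) 2"
    by (intro residue_fps_expansion_over_power_at_0 fps_expansion_intros e1(1) e2(1))
  also have "\<dots> = fps_nth (G \<alpha> x) 0 * fps_nth (G \<beta> y) 2 + fps_nth (G \<alpha> x) 1 * fps_nth (G \<beta> y) 1
      + fps_nth (G \<alpha> x) 2 * fps_nth (G \<beta> y) 0"
    by (simp add: fps_mult_nth numeral_2_eq_2)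
  also have "\<dots> = of_real ((x - 1/2) * (y - 1/2)) + (- fps_nth (G \<alpha> x) 2 / \<beta>) + (- fps_nth (G \<beta> y) 2 / \<alpha>)"
    unfolding e1 e2 by (simp add: field_simps)
  finally show "residue (\<lambda>w. bernoulli_kernel x (\<alpha> * w) * bernoulli_kernel y (\<beta> * w) / w) 0 = \<dots>" .
qed

text \<open>The vertical sides get the bound B and the horizontal sides the bound C, since a
  different kernel decays on each pair of sides.\<close>

lemma norm_contour_integral_rectpath_le:
  assumes cont: "continuous_on (path_image (rectpath a b)) f"
    and "0 \<le> B" "0 \<le> C" "Re a \<le> Re b" "Im a \<le> Im b"
    and B: "\<And>w. w \<in> path_image (rectpath a b) \<Longrightarrow> Re w \<in> {Re a, Re b} \<Longrightarrow> norm (f w) \<le> B"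
    and C: "\<And>w. w \<in> path_image (rectpath a b) \<Longrightarrow> Im w \<in> {Im a, Im b} \<Longrightarrow> norm (f w) \<le> C"
  shows "norm (contour_integral (rectpath a b) f) \<le> 2 * B * (Im b - Im a) + 2 * C * (Re b - Re a)"
proof -
  define a2 where "a2 = Complex (Re b) (Im a)"
  define a4 where "a4 = Complex (Re a) (Im b)"
  have rp: "rectpath a b = linepath a a2 +++ linepath a2 b +++ linepath b a4 +++ linepath a4 a"
    by (simp add: rectpath_def a2_def a4_def Let_def)
  have im: "path_image (rectpath a b) =
      closed_segment a a2 \<union> closed_segment a2 b \<union> closed_segment b a4 \<union> closed_segment a4 a"
    by (simp add: rp path_image_join Un_assoc)
  have ci: "f contour_integrable_on linepath a a2" "f contour_integrable_on linepath a2 b"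
      "f contour_integrable_on linepath b a4" "f contour_integrable_on linepath a4 a"
    by (rule contour_integrable_continuous_linepath, rule continuous_on_subset[OF cont], force simp: im)+
  have eq: "contour_integral (rectpath a b) f = contour_integral (linepath a a2) f
      + (contour_integral (linepath a2 b) f + (contour_integral (linepath b a4) f
      + contour_integral (linepath a4 a) f))"
    unfolding rp using ci by (simp add: contour_integral_join valid_path_join contour_integrable_join)
  have Im1: "Im w \<in> {Im a, Im b}" if "w \<in> closed_segment a a2 \<or> w \<in> closed_segment b a4" for w
    using that by (auto simp: a2_def a4_def closed_segment_same_Im closed_segment_same_Re)
  have Re1: "Re w \<in> {Re a, Re b}" if "w \<in> closed_segment a2 b \<or> w \<in> closed_segment a4 a" for w
    using that by (auto simp: a2_def a4_def closed_segment_same_Im closed_segment_same_Re)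
  have le: "norm (contour_integral (linepath p q) f) \<le> D * norm (q - p)"
    if "f contour_integrable_on linepath p q" "0 \<le> D" "\<And>w. w \<in> closed_segment p q \<Longrightarrow> norm (f w) \<le> D"
    for p q D
    using that by (intro has_contour_integral_bound_linepath[OF has_contour_integral_integral])
  have n: "norm (a2 - a) = Re b - Re a" "norm (b - a2) = Im b - Im a"
     "norm (a4 - b) = Re b - Re a" "norm (a - a4) = Im b - Im a"
    using assms(4,5) by (auto simp: a2_def a4_def cmod_def)
  have "norm (contour_integral (linepath a a2) f) \<le> C * norm (a2 - a)"
       "norm (contour_integral (linepath b a4) f) \<le> C * norm (a4 - b)"
       "norm (contour_integral (linepath a2 b) f) \<le> B * norm (b - a2)"
       "norm (contour_integral (linepath a4 a) f) \<le> B * norm (a - a4)"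
    by (intro le ci assms(2,3) B C Im1 Re1; force simp: im)+
  then show ?thesis
    unfolding eq n by (intro order.trans[OF norm_triangle_ineq]
      order.trans[OF add_left_mono[OF norm_triangle_ineq]]
      order.trans[OF add_left_mono[OF add_left_mono[OF norm_triangle_ineq]]]) linarith
qed

text \<open>The pole is simple: only the first kernel is singular at \<open>w0\<close>, its
  denominator has derivative -\<alpha> there, and the remaining factors are holomorphic
  nearby.\<close>

lemma residue_bernoulli_kernels:
  fixes \<alpha> \<beta> w0 :: complex
  assumes "\<alpha> \<noteq> 0" "w0 \<noteq> 0" "exp (\<alpha> * w0) = 1" "exp (\<beta> * w0) \<noteq> 1"
  shows "residue (\<lambda>w. bernoulli_kernel x (\<alpha> * w) * bernoulli_kernel y (\<beta> * w) / w) w0 =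
    - exp (of_real x * (\<alpha> * w0)) * bernoulli_kernel y (\<beta> * w0) / (\<alpha> * w0)"
proof -
  define f where "f w = exp (of_real x * (\<alpha> * w)) * bernoulli_kernel y (\<beta> * w) / w" for w
  define g where "g w = 1 - exp (\<alpha> * w)" for w
  have "open ({w. exp (\<beta> * w) \<noteq> 1} \<inter> {w. w \<noteq> 0})"
    by (intro open_Int open_Collect_neq continuous_intros)
  then obtain r where r: "r > 0" "ball w0 r \<subseteq> {w. exp (\<beta> * w) \<noteq> 1} \<inter> {w. w \<noteq> 0}"
    using assms openE[of _ w0] by (metis (mono_tags, lifting) IntI mem_Collect_eq)
  have "(g has_field_derivative - \<alpha>) (at w0)"
    unfolding g_def using assms(3) by (auto intro!: derivative_eq_intros)
  moreover have "f holomorphic_on ball w0 r"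
    unfolding f_def by (intro holomorphic_intros) (use r(2) in blast)+
  moreover have "g holomorphic_on ball w0 r"
    unfolding g_def by (intro holomorphic_intros)
  moreover have "f w0 \<noteq> 0" "g w0 = 0"
    using assms by (auto simp: f_def g_def bernoulli_kernel_def)
  ultimately have "residue (\<lambda>w. f w / g w) w0 = f w0 / - \<alpha>"
    using r(1) assms(1)
    by (intro residue_simple_pole_deriv[where s = "ball w0 r"]) (auto simp only: open_ball connected_ball centre_in_ball neg_equal_0_iff_equal)
  moreover have "(\<lambda>w. f w / g w) = (\<lambda>w. bernoulli_kernel x (\<alpha> * w) * bernoulli_kernel y (\<beta> * w) / w)"
    by (simp add: f_def g_def bernoulli_kernel_def[of x] fun_eq_iff field_simps)
  ultimately show ?thesis by (simp add: f_def field_simps)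
qed

section \<open>Poles of the integrand and the residue theorem on a rectangle\<close>

lemma exp_2pii_kernel_pole_iff:
  "exp (2 * of_real pi * \<i> * w) = 1 \<longleftrightarrow> (\<exists>m::int. w = of_int m)"
  unfolding exp_eq_1 by (auto simp: complex_eq_iff)

lemma exp_real_kernel_pole_iff:
  fixes w :: complex and t :: real
  assumes "t > 0"
  shows "exp (- 2 * of_real pi * of_real t * w) = 1 \<longleftrightarrow> (\<exists>m::int. w = - \<i> * of_int m / of_real t)"
proof -
  have "exp (- 2 * of_real pi * of_real t * w) = exp (2 * of_real pi * \<i> * (\<i> * of_real t * w))"
    by (rule arg_cong[of _ _ exp]) (simp add: complex_eq_iff)
  also have "\<dots> = 1 \<longleftrightarrow> (\<exists>m::int. \<i> * of_real t * w = of_int m)"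
    by (rule exp_2pii_kernel_pole_iff)
  also have "\<dots> \<longleftrightarrow> (\<exists>m::int. w = - \<i> * of_int m / of_real t)"
  proof (intro iff_exI)
    fix m :: int
    show "\<i> * of_real t * w = of_int m \<longleftrightarrow> w = - \<i> * of_int m / of_real t"
      using assms by (auto simp: complex_eq_iff field_simps)
  qed
  finally show ?thesis .
qed

lemma exp_2pii_of_int: "exp_2pii (of_int n) = 1"
  by (auto simp: exp_2pii_def exp_2pii_kernel_pole_iff)

text \<open>The poles are the integers and the integer multiples of i/t. The half-sides N + 1/2 and
  (N + 1/2)/t make the rectangle cross each axis midway between consecutive poles. Every pole except
  0 belongs to one kernel only, hence is simple. The residues of l and -l are combined, and
  reflection makes all kernel arguments negative.\<close>

lemma contour_integral_bernoulli_kernels_rectpath: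
  fixes x y t :: real and N :: nat
  assumes t: "t > 0"
  defines "F \<equiv> \<lambda>w. bernoulli_kernel x (2 * of_real pi * \<i> * w) *
    bernoulli_kernel y (- 2 * of_real pi * of_real t * w) / w"
  defines "v \<equiv> Complex (real N + 1/2) ((real N + 1/2) / t)"
  shows "F holomorphic_on (- ({w. exp (2 * of_real pi * \<i> * w) = 1} \<union>
          {w. exp (- 2 * of_real pi * of_real t * w) = 1}))"
    and "path_image (rectpath (- v) v) \<subseteq> - ({w. exp (2 * of_real pi * \<i> * w) = 1} \<union>
          {w. exp (- 2 * of_real pi * of_real t * w) = 1})"
    and "contour_integral (rectpath (- v) v) F = 2 * pi * \<i> * residue F 0
      - (\<Sum>l\<in>{1..N}.
          ((exp_2pii (of_real (real l * x)) * bernoulli_kernel y (- 2 * pi * l * t)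
          + exp_2pii (- of_real (real l * x)) * bernoulli_kernel (1 - y) (- 2 * pi * l * t))
          - (exp_2pii (- of_real (real l * y)) * bernoulli_kernel x (- 2 * pi * l / t)
          + exp_2pii (of_real (real l * y)) * bernoulli_kernel (1 - x) (- 2 * pi * l / t))) / of_nat l)"
proof -
  define PA where "PA = {w. exp (2 * of_real pi * \<i> * w) = 1}"
  define PB :: "complex set" where "PB = {w. exp (- 2 * of_real pi * of_real t * w) = 1}"
  have PA: "w \<in> PA \<longleftrightarrow> (\<exists>m::int. w = of_int m)" for w
    unfolding PA_def mem_Collect_eq by (rule exp_2pii_kernel_pole_iff)
  have PB: "w \<in> PB \<longleftrightarrow> (\<exists>m::int. w = - \<i> * of_int m / of_real t)" for w
    unfolding PB_def mem_Collect_eq using exp_real_kernel_pole_iff[OF t] by blast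
  have "0 \<in> PA" by (simp add: PA_def)
  then show holo: "F holomorphic_on - (PA \<union> PB)"
    unfolding F_def PA_def PB_def by (intro holomorphic_intros) auto
  define h where "h = real N + 1/2"
  have v: "Re v = h" "Im v = h / t" by (simp_all add: v_def h_def)
  have h0: "h > 0" by (simp add: h_def)
  have noint: "of_int m \<noteq> h" "of_int m \<noteq> - h" for m :: int
  proof -
    have "2 * m \<noteq> 2 * int N + 1" "2 * m \<noteq> - (2 * int N + 1)" by presburger+
    then have "real_of_int (2 * m) \<noteq> real_of_int (2 * int N + 1)" "real_of_int (2 * m) \<noteq> real_of_int (- (2 * int N + 1))"
      by (simp_all only: of_int_eq_iff not_False_eq_True)
    then show "of_int m \<noteq> h" "of_int m \<noteq> - h" by (auto simp: h_def)
  qed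
  have ins: "path_image (rectpath (- v) v) \<subseteq> cbox (- v) v - box (- v) v"
    using h0 t by (subst path_image_rectpath_cbox_minus_box) (auto simp: v)
  show pi: "path_image (rectpath (- v) v) \<subseteq> - (PA \<union> PB)"
  proof (safe)
    fix w assume w: "w \<in> path_image (rectpath (- v) v)" "w \<in> PA"
    then obtain m :: int where "w = of_int m" using PA by blast
    then show False using w(1) ins noint[of m] h0 t
      by (auto simp: in_cbox_complex_iff in_box_complex_iff v field_simps less_le subset_iff)
  next
    fix w assume w: "w \<in> path_image (rectpath (- v) v)" "w \<in> PB"
    then obtain m :: int where "w = - \<i> * of_int m / of_real t" using PB by blast
    then have Re: "Re w = 0" and Im: "Im w = - of_int m / t" by simp_all
    have "w \<in> cbox (- v) v" "w \<notin> box (- v) v" using w(1) ins by blast+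
    then have "- h / t \<le> - of_int m / t \<and> - of_int m / t \<le> h / t"
        "\<not> (- h / t < - of_int m / t \<and> - of_int m / t < h / t)"
      using h0 by (simp_all add: in_cbox_complex_iff in_box_complex_iff v Re Im)
    then have "- h \<le> - of_int m \<and> - of_int m \<le> h" "\<not> (- h < - of_int m \<and> - of_int m < h)"
      using t by (simp_all only: divide_le_cancel divide_less_cancel) auto
    then show False using noint[of m] by linarith
  qed
  \<comment> \<open>The residue theorem needs an open set around the closed rectangle. Enlarging h =
    N + 1/2 by 1/4 encloses no further pole, since N + 3/4 < N + 1.\<close>
  define v' where "v' = Complex (h + 1/4) ((h + 1/4) / t)"
  have v': "Re v' = h + 1/4" "Im v' = (h + 1/4) / t" by (simp_all add: v'_def)
  define S where "S = box (- v') v'"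
  define M where "M = int ` {1..N} \<union> (\<lambda>l. - int l) ` {1..N}"
  define p where "p = (\<lambda>m::int. - \<i> * of_int m / complex_of_real t)"
  define pts where "pts = insert 0 ((of_int ` M) \<union> (p ` M))"
  have M: "m \<in> M" if "\<bar>of_int m\<bar> < h + 1/4" "m \<noteq> 0" for m :: int
  proof -
    have "real_of_int \<bar>m\<bar> < of_int (int N + 1)" using that(1) by (simp add: h_def)
    then have "\<bar>m\<bar> < int N + 1" by (simp only: of_int_less_iff)
    then have "nat \<bar>m\<bar> \<in> {1..N}" using that(2) by auto
    moreover have "m = int (nat \<bar>m\<bar>) \<or> m = - int (nat \<bar>m\<bar>)" by linarith
    ultimately show ?thesis unfolding M_def by blast
  qed
  have Mb: "\<bar>real_of_int m\<bar> \<le> real N" "m \<noteq> 0" if "m \<in> M" for m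
    using that by (auto simp: M_def)
  have sub: "S \<inter> (PA \<union> PB) \<subseteq> pts"
  proof
    fix w assume w: "w \<in> S \<inter> (PA \<union> PB)"
    then consider (a) m :: int where "w = of_int m" | (b) m :: int where "w = p m"
      unfolding p_def using PA PB by blast
    then show "w \<in> pts"
    proof cases
      case a
      have "\<bar>of_int m\<bar> < h + 1/4"
        using w a by (auto simp: S_def in_box_complex_iff v' abs_if)
      then show ?thesis using M[of m] a by (auto simp: pts_def)
    next
      case b
      have "\<bar>of_int m\<bar> < h + 1/4"
        using w b t by (auto simp: S_def in_box_complex_iff v' abs_if p_def field_simps)
      then show ?thesis using M[of m] b by (auto simp: pts_def p_def)
    qed
  qed
  have inbox: "w \<in> box (- v) v" if "w \<in> pts" for w
  proof -
    consider "w = 0" | m where "m \<in> M" "w = of_int m" | m where "m \<in> M" "w = p m"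
      using \<open>w \<in> pts\<close> by (auto simp: pts_def)
    then show ?thesis
    proof cases
      case 1 then show ?thesis using h0 t by (simp add: in_box_complex_iff v)
    next
      case 2
      then have "of_int m < h \<and> - h < of_int m" using Mb(1)[of m] by (simp add: h_def) linarith
      then show ?thesis using 2 h0 t by (simp add: in_box_complex_iff v)
    next
      case 3
      then have "of_int m < h \<and> - h < of_int m" using Mb(1)[of m] by (simp add: h_def) linarith
      then have "- h / t < - of_int m / t \<and> - of_int m / t < h / t"
        using t by (intro conjI divide_strict_right_mono) auto
      then show ?thesis using 3 h0 by (simp add: in_box_complex_iff v p_def)
    qed
  qed
  have "cbox (- v) v \<subseteq> S"
    using t by (auto simp: S_def in_box_complex_iff in_cbox_complex_iff v v' field_simps)
  have fin: "finite pts" by (simp add: pts_def M_def)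
  have "contour_integral (rectpath (- v) v) F =
      2 * pi * \<i> * (\<Sum>p\<in>pts. winding_number (rectpath (- v) v) p * residue F p)"
  proof (rule Residue_theorem)
    show "open S" "connected S" by (auto simp: S_def convex_connected intro: open_box)
    show "F holomorphic_on S - pts"
      by (rule holomorphic_on_subset[OF holo]) (use sub in auto)
    show "path_image (rectpath (- v) v) \<subseteq> S - pts"
      using ins inbox \<open>cbox (- v) v \<subseteq> S\<close> by blast
    show "\<forall>z. z \<notin> S \<longrightarrow> winding_number (rectpath (- v) v) z = 0"
      using \<open>cbox (- v) v \<subseteq> S\<close> h0 t by (auto intro!: winding_number_rectpath_outside simp: v)
  qed (use fin in auto)
  also have "\<dots> = 2 * pi * \<i> * (\<Sum>p\<in>pts. residue F p)"
    using inbox by (simp add: winding_number_rectpath)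
  also have "(\<Sum>p\<in>pts. residue F p) = residue F 0 + ((\<Sum>m\<in>M. residue F (of_int m)) + (\<Sum>m\<in>M. residue F (p m)))"
  proof -
    have "0 \<notin> of_int ` M \<union> p ` M" using Mb(2) t by (auto simp: p_def)
    moreover have "of_int ` M \<inter> p ` M = {}"
      using Mb(2) t by (auto simp: p_def complex_eq_iff)
    moreover have "inj_on p M" "inj_on (of_int :: int \<Rightarrow> complex) M"
      using t by (auto simp: inj_on_def p_def)
    moreover have "finite M" by (simp add: M_def)
    ultimately show ?thesis
      unfolding pts_def by (simp add: sum.union_disjoint sum.reindex)
  qed
  also have "(\<Sum>m\<in>M. residue F (of_int m)) = (\<Sum>m\<in>M. - exp_2pii (of_int m * of_real x) *
      bernoulli_kernel y (- 2 * pi * t * of_int m) / (2 * pi * \<i> * of_int m))"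
  proof (rule sum.cong[OF refl])
    fix m assume m: "m \<in> M"
    have "of_int m \<notin> PB" using Mb(2)[OF m] t by (auto simp: PB complex_eq_iff)
    moreover have "of_int m \<in> PA" by (auto simp: PA)
    ultimately show "residue F (of_int m) = - exp_2pii (of_int m * of_real x) *
      bernoulli_kernel y (- 2 * pi * t * of_int m) / (2 * pi * \<i> * of_int m)"
      unfolding F_def using Mb(2)[OF m]
      by (subst residue_bernoulli_kernels) (simp_all add: PA_def PB_def exp_2pii_def mult_ac)
  qed
  also have "(\<Sum>m\<in>M. residue F (p m)) = (\<Sum>m\<in>M. - exp_2pii (of_int m * of_real y) *
      bernoulli_kernel x (2 * pi * of_int m / t) / (2 * pi * \<i> * of_int m))"
  proof (rule sum.cong[OF refl])
    fix m assume m: "m \<in> M"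
    \<comment> \<open>Swapping the factors lets \<open>residue_bernoulli_kernels\<close> apply with
      the other kernel as the singular one.\<close>
    have F: "F = (\<lambda>w. bernoulli_kernel y (- 2 * of_real pi * of_real t * w) *
       bernoulli_kernel x (2 * of_real pi * \<i> * w) / w)"
      by (simp add: F_def mult_ac)
    have "p m \<notin> PA" using Mb(2)[OF m] t by (auto simp: PA p_def complex_eq_iff)
    moreover have "p m \<in> PB" by (auto simp: PB p_def)
    moreover have "p m \<noteq> 0" using Mb(2)[OF m] t by (simp add: p_def)
    ultimately have "residue F (p m) = - exp (of_real y * (- 2 * pi * t * p m)) *
       bernoulli_kernel x (2 * pi * \<i> * p m) / (- 2 * pi * t * p m)"
      unfolding F using Mb(2)[OF m] t
      by (subst residue_bernoulli_kernels) (simp_all add: PA_def PB_def)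
    also have "- 2 * pi * t * p m = 2 * pi * \<i> * of_int m"
      using t by (simp add: p_def)
    also have "2 * pi * \<i> * p m = 2 * pi * of_int m / t"
      by (simp add: p_def complex_eq_iff)
    finally show "residue F (p m) = - exp_2pii (of_int m * of_real y) *
      bernoulli_kernel x (2 * pi * of_int m / t) / (2 * pi * \<i> * of_int m)"
      by (simp add: exp_2pii_def mult_ac)
  qed
  also have sM: "(\<Sum>m\<in>M. G m) = (\<Sum>l\<in>{1..N}. G (int l) + G (- int l))" for G :: "int \<Rightarrow> complex"
  proof -
    have "int ` {1..N} \<inter> (\<lambda>l. - int l) ` {1..N} = {}" by auto
    then show ?thesis
      unfolding M_def by (simp add: sum.union_disjoint sum.reindex inj_on_def sum.distrib)
  qed
  also note sM
  \<comment> \<open>Positive kernel arguments are kept as negatives of negative ones, ready for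
    \<open>bernoulli_kernel_minus\<close>.\<close>
  finally have eq: "contour_integral (rectpath (- v) v) F = 2 * pi * \<i> * residue F 0 +
      (\<Sum>l\<in>{1..N}. 2 * pi * \<i> * (- exp_2pii (of_nat l * of_real x) *
      bernoulli_kernel y (- 2 * pi * t * of_nat l) / (2 * pi * \<i> * of_nat l)
      + - exp_2pii (- of_nat l * of_real x) *
      bernoulli_kernel y (- (- 2 * pi * t * of_nat l)) / (2 * pi * \<i> * - of_nat l)) + 2 * pi * \<i> * (
      - exp_2pii (of_nat l * of_real y) *
      bernoulli_kernel x (- (- 2 * pi * of_nat l / t)) / (2 * pi * \<i> * of_nat l)
      + - exp_2pii (- of_nat l * of_real y) *
      bernoulli_kernel x (- 2 * pi * of_nat l / t) / (2 * pi * \<i> * - of_nat l)))"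
    by (simp add: ring_distribs sum_distrib_left sum.distrib)
  show "contour_integral (rectpath (- v) v) F = 2 * pi * \<i> * residue F 0
      - (\<Sum>l\<in>{1..N}.
          ((exp_2pii (of_real (real l * x)) * bernoulli_kernel y (- 2 * pi * l * t)
          + exp_2pii (- of_real (real l * x)) * bernoulli_kernel (1 - y) (- 2 * pi * l * t))
          - (exp_2pii (- of_real (real l * y)) * bernoulli_kernel x (- 2 * pi * l / t)
          + exp_2pii (of_real (real l * y)) * bernoulli_kernel (1 - x) (- 2 * pi * l / t))) / of_nat l)"
    unfolding eq diff_conv_add_uminus[of "2 * pi * \<i> * residue F 0"] sum_negf[symmetric]
  proof (intro arg_cong2[of _ _ _ _ "(+)"] refl sum.cong)
    fix l assume l: "l \<in> {1..N}"
    have k1: "bernoulli_kernel y (- (- 2 * pi * t * of_nat l)) = - bernoulli_kernel (1 - y) (- 2 * pi * l * t)"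
      by (simp only: of_real_minus bernoulli_kernel_minus) (simp add: mult_ac)
    have k2: "bernoulli_kernel x (- (- 2 * pi * of_nat l / t)) = - bernoulli_kernel (1 - x) (- 2 * pi * l / t)"
      by (simp only: of_real_minus bernoulli_kernel_minus)
    have cancel: "2 * pi * \<i> * (- A / (2 * pi * \<i> * of_nat l) + - B / (2 * pi * \<i> * - of_nat l)) +
       2 * pi * \<i> * (- C / (2 * pi * \<i> * of_nat l) + - D / (2 * pi * \<i> * - of_nat l)) =
       - (((A - B) - (D - C)) / of_nat l)" for A B C D :: complex
      using l by (simp add: field_simps)
    show "2 * pi * \<i> * (- exp_2pii (of_nat l * of_real x) *
      bernoulli_kernel y (- 2 * pi * t * of_nat l) / (2 * pi * \<i> * of_nat l)
      + - exp_2pii (- of_nat l * of_real x) *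
      bernoulli_kernel y (- (- 2 * pi * t * of_nat l)) / (2 * pi * \<i> * - of_nat l)) + 2 * pi * \<i> * (
      - exp_2pii (of_nat l * of_real y) *
      bernoulli_kernel x (- (- 2 * pi * of_nat l / t)) / (2 * pi * \<i> * of_nat l)
      + - exp_2pii (- of_nat l * of_real y) *
      bernoulli_kernel x (- 2 * pi * of_nat l / t) / (2 * pi * \<i> * - of_nat l)) =
      - (((exp_2pii (of_real (real l * x)) * bernoulli_kernel y (- 2 * pi * l * t)
          + exp_2pii (- of_real (real l * x)) * bernoulli_kernel (1 - y) (- 2 * pi * l * t))
          - (exp_2pii (- of_real (real l * y)) * bernoulli_kernel x (- 2 * pi * l / t)
          + exp_2pii (of_real (real l * y)) * bernoulli_kernel (1 - x) (- 2 * pi * l / t))) / of_nat l)"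
      unfolding k1 k2 mult_minus_left[of "exp_2pii _"] cancel by (simp add: mult_ac)
  qed
qed

text \<open>On the vertical sides the argument of the first kernel has imaginary part an odd
  multiple of \<pi>, so this kernel has norm at most 1, while the second decays exponentially in N.
  On the horizontal sides the roles are exchanged. The strict bounds on x and y make both decay
  rates positive.\<close>

lemma bernoulli_kernel_contour_tendsto_0:
  fixes x y t :: real
  assumes x: "0 < x" "x < 1" and y: "0 < y" "y < 1" and t: "t > 0"
  defines "F \<equiv> \<lambda>w. bernoulli_kernel x (2 * of_real pi * \<i> * w) *
    bernoulli_kernel y (- 2 * of_real pi * of_real t * w) / w"
  defines "v \<equiv> \<lambda>N. Complex (real N + 1/2) ((real N + 1/2) / t)"
  shows "(\<lambda>N. contour_integral (rectpath (- v N) (v N)) F) \<longlonglongrightarrow> 0"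
proof -
  define dx where "dx = min x (1 - x) * (2 * pi / t)"
  define dy where "dy = min y (1 - y) * (2 * pi * t)"
  have d0: "dx > 0" "dy > 0" using x y t by (simp_all add: dx_def dy_def)
  \<comment> \<open>The two conditions on N supply the hypothesis of
    \<open>norm_bernoulli_kernel_decay\<close> for the two kernels; both hold eventually.\<close>
  have bound: "norm (contour_integral (rectpath (- v N) (v N)) F) \<le>
      (8 / t) * exp (- dy * (real N + 1/2)) + (8 * t) * exp (- dx * (real N + 1/2))"
    if N: "1 \<le> 2 * pi * t * (real N + 1/2)" "1 \<le> 2 * pi / t * (real N + 1/2)" for N
  proof -
    define h where "h = real N + 1/2"
    have v: "Re (v N) = h" "Im (v N) = h / t" by (simp_all add: v_def h_def)
    have h0: "h > 0" by (simp add: h_def)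
    have cis_h: "cis (2 * pi * h) = -1" "cis (- 2 * pi * h) = -1"
    proof -
      have "2 * pi * h = pi + of_nat N * (2 * pi)" by (simp add: h_def algebra_simps)
      then show "cis (2 * pi * h) = -1" by (simp add: cis_mult[symmetric] mult.commute[of _ "2*pi"])
      then show "cis (- 2 * pi * h) = -1" using cis_inverse[of "2 * pi * h"] by simp
    qed
    have expR: "exp u = - of_real (exp (Re u))" if "Im u = 2 * pi * h \<or> Im u = - 2 * pi * h" for u
      using that cis_h by (auto simp: exp_eq_polar exp_of_real)
    have vN: "v N = Complex (real N + 1/2) ((real N + 1/2) / t)" by (simp add: v_def)
    note ci = contour_integral_bernoulli_kernels_rectpath(1)[OF t, where x = x and y = y, folded F_def]
      contour_integral_bernoulli_kernels_rectpath(2)[OF t, where N = N, folded vN]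
    have "norm (contour_integral (rectpath (- v N) (v N)) F) \<le>
       2 * (2 * exp (- dy * h) / h) * (Im (v N) - Im (- v N)) +
       2 * (2 * exp (- dx * h) / (h / t)) * (Re (v N) - Re (- v N))"
    proof (rule norm_contour_integral_rectpath_le)
      show "continuous_on (path_image (rectpath (- v N) (v N))) F"
        using ci(1,2) by (intro holomorphic_on_imp_continuous_on) (rule holomorphic_on_subset)
    next
      fix w assume "Re w \<in> {Re (- v N), Re (v N)}"
      then have Rw: "\<bar>Re w\<bar> = h" using h0 by (auto simp: v)
      have "norm (bernoulli_kernel x (2 * of_real pi * \<i> * w)) \<le> 1"
        using x Rw by (intro norm_bernoulli_kernel_le_1 expR) (auto simp: abs_if split: if_splits)
      moreover have "norm (bernoulli_kernel y (- 2 * of_real pi * of_real t * w)) \<le>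
          2 * exp (- min y (1 - y) * \<bar>Re (- 2 * of_real pi * of_real t * w)\<bar>)"
        using N Rw t by (intro norm_bernoulli_kernel_decay) (simp add: abs_mult h_def)
      moreover have "\<bar>Re (- 2 * of_real pi * of_real t * w)\<bar> = 2 * pi * t * h"
        using Rw t by (simp add: abs_mult)
      moreover have "h \<le> norm w" using abs_Re_le_cmod[of w] Rw by simp
      ultimately have "norm (F w) \<le> 1 * (2 * exp (- min y (1 - y) * (2 * pi * t * h))) / h"
        unfolding F_def norm_divide norm_mult using h0 by (intro frac_le mult_mono) auto
      then show "norm (F w) \<le> 2 * exp (- dy * h) / h" by (simp add: dy_def mult_ac)
    next
      fix w assume "Im w \<in> {Im (- v N), Im (v N)}"
      then have Iw: "\<bar>Im w\<bar> = h / t" using h0 t by (auto simp: v)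
      then have "Im w = h / t \<or> Im w = - (h / t)" by linarith
      then have "norm (bernoulli_kernel y (- 2 * of_real pi * of_real t * w)) \<le> 1"
        using y t by (intro norm_bernoulli_kernel_le_1 expR) auto
      moreover have "norm (bernoulli_kernel x (2 * of_real pi * \<i> * w)) \<le>
          2 * exp (- min x (1 - x) * \<bar>Re (2 * of_real pi * \<i> * w)\<bar>)"
        using N Iw t by (intro norm_bernoulli_kernel_decay) (simp add: abs_mult h_def)
      moreover have "\<bar>Re (2 * of_real pi * \<i> * w)\<bar> = 2 * pi * (h / t)"
        using Iw t by (simp add: abs_mult)
      moreover have "h / t \<le> norm w" using abs_Im_le_cmod[of w] Iw by simp
      ultimately have "norm (F w) \<le> (2 * exp (- min x (1 - x) * (2 * pi * (h / t)))) * 1 / (h / t)"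
        unfolding F_def norm_divide norm_mult using h0 t by (intro frac_le mult_mono) auto
      then show "norm (F w) \<le> 2 * exp (- dx * h) / (h / t)" by (simp add: dx_def mult_ac)
    qed (use h0 t in \<open>auto simp: v\<close>)
    also have "\<dots> = (8 / t) * exp (- dy * h) + (8 * t) * exp (- dx * h)"
      using h0 t by (simp add: v field_simps)
    finally show ?thesis by (simp add: h_def)
  qed
  have big: "\<forall>\<^sub>F N in sequentially. 1 \<le> s * (real N + 1/2)" if "s > 0" for s :: real
  proof -
    have "\<forall>\<^sub>F N in sequentially. 1 / s \<le> real N"
      using eventually_ge_at_top[of "nat \<lceil>1 / s\<rceil>"] by eventually_elim linarith
    then show ?thesis
    proof eventually_elim
      case (elim N)
      then have "1 / s \<le> real N + 1/2" by linarith
      then show ?case using that by (simp add: field_simps)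
    qed
  qed
  have lim: "(\<lambda>N. exp (- d * (real N + 1/2))) \<longlonglongrightarrow> 0" if "d > 0" for d :: real
    using that by real_asymp
  have "\<forall>\<^sub>F N in sequentially. norm (contour_integral (rectpath (- v N) (v N)) F) \<le>
      (8 / t) * exp (- dy * (real N + 1/2)) + (8 * t) * exp (- dx * (real N + 1/2))"
    by (rule eventually_mono[OF eventually_conj[OF big[of "2 * pi * t"] big[of "2 * pi / t"]]])
       (use t bound in auto)
  moreover have "(\<lambda>N. (8 / t) * exp (- dy * (real N + 1/2)) + (8 * t) * exp (- dx * (real N + 1/2)))
      \<longlonglongrightarrow> (8 / t) * 0 + (8 * t) * 0"
    by (intro tendsto_intros lim d0)
  ultimately show ?thesis
    by (auto intro: Lim_null_comparison)
qed

text \<open>The contour integrals tend to 0, so the partial sums tend to 2 \<pi> i times the residue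
  at 0. \<open>g\<close> and \<open>h\<close> are obtained before x and y, hence are the same for
  all pairs; the later cancellation relies on this.\<close>

lemma bernoulli_kernel_reciprocity:
  fixes t :: real
  assumes t: "t > 0"
  obtains g h :: "real \<Rightarrow> complex" where
    "\<And>x y. 0 < x \<Longrightarrow> x < 1 \<Longrightarrow> 0 < y \<Longrightarrow> y < 1 \<Longrightarrow>
      (\<lambda>N. \<Sum>l\<in>{1..N}.
          ((exp_2pii (of_real (real l * x)) * bernoulli_kernel y (- 2 * pi * l * t)
          + exp_2pii (- of_real (real l * x)) * bernoulli_kernel (1 - y) (- 2 * pi * l * t))
          - (exp_2pii (- of_real (real l * y)) * bernoulli_kernel x (- 2 * pi * l / t)
          + exp_2pii (of_real (real l * y)) * bernoulli_kernel (1 - x) (- 2 * pi * l / t))) / of_nat l)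
        \<longlonglongrightarrow> 2 * pi * \<i> * of_real ((x - 1/2) * (y - 1/2)) + g x + h y"
proof -
  have "(2 * of_real pi * \<i> :: complex) \<noteq> 0" "(- 2 * of_real pi * of_real t :: complex) \<noteq> 0"
    using t by auto
  then obtain g h :: "real \<Rightarrow> complex" where gh: "\<And>x y. residue (\<lambda>w. bernoulli_kernel x (2 * of_real pi * \<i> * w) *
    bernoulli_kernel y (- 2 * of_real pi * of_real t * w) / w) 0
       = of_real ((x - 1/2) * (y - 1/2)) + g x + h y"
    using residue_bernoulli_kernels_at_0 by blast
  show ?thesis
  proof (rule that[of "\<lambda>x. 2 * pi * \<i> * g x" "\<lambda>y. 2 * pi * \<i> * h y"])
    fix x y :: real
    assume xy: "0 < x" "x < 1" "0 < y" "y < 1"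
    define A where "A N = (\<Sum>l\<in>{1..N}.
          ((exp_2pii (of_real (real l * x)) * bernoulli_kernel y (- 2 * pi * l * t)
          + exp_2pii (- of_real (real l * x)) * bernoulli_kernel (1 - y) (- 2 * pi * l * t))
          - (exp_2pii (- of_real (real l * y)) * bernoulli_kernel x (- 2 * pi * l / t)
          + exp_2pii (of_real (real l * y)) * bernoulli_kernel (1 - x) (- 2 * pi * l / t))) / of_nat l)" for N
    have "(\<lambda>N. 2 * pi * \<i> * (of_real ((x - 1/2) * (y - 1/2)) + g x + h y) - A N) \<longlonglongrightarrow> 0"
      using bernoulli_kernel_contour_tendsto_0[OF xy t]
      unfolding contour_integral_bernoulli_kernels_rectpath(3)[OF t] gh A_def .
    from tendsto_diff[OF tendsto_const[of "2 * pi * \<i> * (of_real ((x - 1/2) * (y - 1/2)) + g x + h y)"] this]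
    show "A \<longlonglongrightarrow> 2 * pi * \<i> * of_real ((x - 1/2) * (y - 1/2)) + 2 * pi * \<i> * g x + 2 * pi * \<i> * h y"
      by (simp add: ring_distribs)
  qed
qed

section \<open>Gauss sums of primitive characters\<close>

text \<open>An affine map with unit slope is injective on residues modulo q, hence permutes
  them.\<close>

lemma sum_mod_affine:
  fixes f :: "int \<Rightarrow> 'a::comm_monoid_add"
  assumes "q > 0" "coprime u q" "\<And>n. f (n mod q) = f n"
  shows "(\<Sum>n\<in>{0..<q}. f (u * n + s)) = (\<Sum>n\<in>{0..<q}. f n)"
proof -
  define g where "g n = (u * n + s) mod q" for n
  have inj: "inj_on g {0..<q}"
  proof (rule inj_onI)
    fix m n assume mn: "m \<in> {0..<q}" "n \<in> {0..<q}" "g m = g n"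
    then have "[u * m + s = u * n + s] (mod q)" by (simp add: g_def cong_def)
    then have "[m = n] (mod q)"
      using assms(2) by (simp add: cong_add_rcancel cong_mult_lcancel)
    then show "m = n" using mn by (simp add: cong_def)
  qed
  have "g ` {0..<q} \<subseteq> {0..<q}" using assms(1) by (auto simp: g_def)
  then have "g ` {0..<q} = {0..<q}"
    using inj by (intro endo_inj_surj) auto
  then have "(\<Sum>n\<in>{0..<q}. f n) = (\<Sum>n\<in>{0..<q}. f (g n))"
    using sum.reindex[OF inj, of f] by simp
  then show ?thesis by (simp add: g_def assms(3))
qed

lemma exists_coprime_lift:
  fixes n m q :: int
  assumes "coprime n m" "q \<noteq> 0"
  shows "\<exists>n'. coprime n' q \<and> [n' = n] (mod m)"
proof -
  \<comment> \<open>Each prime factor of \<open>q\<close> divides exactly one of \<open>n\<close> and \<open>k m\<close>.\<close>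
  define k where "k = (\<Prod>p\<in>{p \<in> prime_factors q. \<not> p dvd n}. p)"
  have "coprime (n + k * m) q"
  proof (rule ccontr)
    assume "\<not> coprime (n + k * m) q"
    then have "\<not> is_unit (gcd (n + k * m) q)" by (simp add: coprime_iff_gcd_eq_1)
    then obtain p where p: "prime p" "p dvd gcd (n + k * m) q"
      using prime_divisor_exists[of "gcd (n + k * m) q"] assms(2) by auto
    then have pq: "p dvd q" "p dvd n + k * m" by simp_all
    have pk: "p dvd k \<longleftrightarrow> \<not> p dvd n"
    proof
      assume "p dvd k"
      then obtain p' where "p' \<in> prime_factors q" "\<not> p' dvd n" "p dvd p'"
        unfolding k_def using p(1) by (subst (asm) prime_dvd_prod_iff) auto
      then show "\<not> p dvd n" using p(1) primes_dvd_imp_eq[of p p'] by auto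
    next
      assume "\<not> p dvd n"
      then have "p \<in> {p \<in> prime_factors q. \<not> p dvd n}"
        using p(1) pq(1) assms(2) by (simp add: prime_factors_dvd)
      then show "p dvd k" unfolding k_def by (intro dvd_prodI) auto
    qed
    show False
    proof (cases "p dvd n")
      case True
      then have "p dvd k * m" using pq(2) by (simp add: dvd_add_right_iff)
      then have "p dvd m" using pk True p(1) prime_dvd_mult_iff by blast
      then show False using True assms(1) p(1) by (meson coprime_common_divisor not_prime_unit)
    next
      case False
      then have "p dvd k * m" using pk by simp
      then show False using pq(2) False by (simp add: dvd_add_left_iff)
    qed
  qed
  then show ?thesis by (intro exI[of _ "n + k * m"]) (auto simp: cong_def)
qed

lemma exp_2pii_add: "exp_2pii (x + y) = exp_2pii x * exp_2pii y"
  by (simp add: exp_2pii_def ring_distribs exp_add)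

lemma exp_2pii_cong:
  assumes "[m = n] (mod c)" "c \<noteq> 0"
  shows "exp_2pii (of_int m / of_int c) = exp_2pii (of_int n / of_int c)"
proof -
  obtain k where "m = n + c * k" using assms(1) by (metis cong_iff_lin cong_sym)
  then have "of_int m / of_int c = of_int n / of_int c + (of_int k :: complex)"
    using assms(2) by (simp add: field_simps)
  then show ?thesis by (simp add: exp_2pii_add exp_2pii_of_int)
qed

section \<open>Dirichlet characters: periodicity, absolute values, Gauss sums\<close>

locale dirichlet =
  fixes q :: nat and chi :: "int \<Rightarrow> complex"
  assumes dirichlet: "dirichlet_character q chi"
begin

lemma modulus_pos: "int q > 0"
  and chi_mult: "chi (m * n) = chi m * chi n"
  and chi_eq_0_iff: "chi n = 0 \<longleftrightarrow> \<not> coprime n (int q)"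
  using dirichlet by (auto simp: dirichlet_character_def)

lemma chi_add_mult: "chi (n + k * int q) = chi n"
proof (induction k rule: int_induct[where k = 0])
  case (step1 i)
  have "chi (n + (i + 1) * int q) = chi ((n + i * int q) + int q)" by (simp add: algebra_simps)
  then show ?case using dirichlet step1 by (simp add: dirichlet_character_def)
next
  case (step2 i)
  have "chi (n + i * int q) = chi ((n + (i - 1) * int q) + int q)" by (simp add: algebra_simps)
  then show ?case using dirichlet step2 by (simp add: dirichlet_character_def)
qed simp

lemma chi_cong: "[m = n] (mod int q) \<Longrightarrow> chi m = chi n"
  using chi_add_mult by (metis cong_iff_lin mult.commute)

lemma chi_mod: "int q dvd c \<Longrightarrow> chi (n mod c) = chi n"
  by (intro chi_cong) (metis cong_def mod_mod_cancel)

lemma chi_1: "chi 1 = 1"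
  using chi_mult[of 1 1] chi_eq_0_iff[of 1] by auto

lemma norm_chi_le: "norm (chi n) \<le> 1"
proof (rule ccontr)
  assume "\<not> norm (chi n) \<le> 1"
  \<comment> \<open>The powers of \<open>chi n\<close> are values of \<open>chi\<close>, hence bounded.\<close>
  define B where "B = Max ((\<lambda>n. norm (chi n)) ` {0..<int q})"
  have B: "norm (chi m) \<le> B" for m
    unfolding B_def using modulus_pos chi_mod[of "int q" m] by (intro Max_ge) (auto intro!: image_eqI[of _ _ "m mod int q"])
  obtain k where "B < norm (chi n) ^ k"
    using real_arch_pow \<open>\<not> norm (chi n) \<le> 1\<close> by (metis not_le)
  also have "norm (chi n) ^ k = norm (chi (n ^ k))"
    by (induction k) (simp_all add: chi_1 chi_mult norm_mult)
  finally show False using B[of "n ^ k"] by simp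
qed

text \<open>An inverse of n modulo q yields two character values of norm at most 1 whose norms
  multiply to 1.\<close>

lemma norm_chi: "norm (chi n) = 1" if n: "coprime n (int q)"
proof -
  obtain m where "[n * m = 1] (mod int q)"
    using cong_solve_coprime_int[OF n] by blast
  then have "norm (chi n) * norm (chi m) = 1"
    using chi_cong chi_1 chi_mult by (metis norm_mult norm_one)
  then show ?thesis
    using norm_chi_le[of n] norm_chi_le[of m] mult_left_le[of "norm (chi m)" "norm (chi n)"] by simp
qed

text \<open>
  Otherwise \<open>chi\<close> would be induced by a character modulo \<open>m\<close>, obtained by lifting residues coprime
  to \<open>m\<close> to residues coprime to \<open>q\<close>.
\<close>

lemma exists_coprime_chi_ne_1:
  assumes "conductor q chi = q" "int m dvd int q" "m < q"
  obtains u where "coprime u (int q)" "[u = 1] (mod int m)" "chi u \<noteq> 1"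
proof (rule ccontr)
  assume "\<not> thesis"
  with that have triv: "chi u = 1" if "coprime u (int q)" "[u = 1] (mod int m)" for u
    using that by blast
  \<comment> \<open>This makes \<open>chi'\<close> below independent of the chosen lift. With w an
    inverse of b modulo q, a w is 1 modulo m, so \<open>triv\<close> applies to it.\<close>
  have same: "chi a = chi b" if a: "coprime a (int q)" and b: "coprime b (int q)" and ab: "[a = b] (mod int m)" for a b
  proof -
    obtain w where w: "[b * w = 1] (mod int q)"
      using cong_solve_coprime_int[OF b] by auto
    then have wq: "coprime w (int q)"
      by (metis coprime_iff_invertible_int mult.commute)
    have "[b * w = 1] (mod int m)" using w assms(2) cong_dvd_modulus by blast
    then have "[a * w = 1] (mod int m)" using ab cong_mult[OF ab cong_refl[of w]] cong_trans by blast
    then have "chi (a * w) = 1" using a wq by (intro triv) simp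
    moreover have "chi (b * w) = 1" using chi_cong[OF w] chi_1 by simp
    ultimately show ?thesis
      using chi_eq_0_iff[of w] wq mult_right_cancel[of "chi w" "chi a" "chi b"] by (simp add: chi_mult)
  qed
  have q0: "int q \<noteq> 0" using modulus_pos by simp
  define lift where "lift n = (SOME n'. coprime n' (int q) \<and> [n' = n] (mod int m))" for n
  have lift: "coprime (lift n) (int q)" "[lift n = n] (mod int m)" if "coprime n (int m)" for n
    using someI_ex[OF exists_coprime_lift[OF that q0]] by (auto simp: lift_def)
  define chi' where "chi' n = (if coprime n (int m) then chi (lift n) else 0)" for n
  have chi'_eq: "chi' n = chi b" if "coprime b (int q)" "[b = n] (mod int m)" for n b
  proof -
    have "coprime b (int m)" by (rule coprime_divisors[OF dvd_refl assms(2) that(1)])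
    then have n: "coprime n (int m)" by (rule cong_imp_coprime[OF that(2)])
    have "chi (lift n) = chi b"
      using lift[OF n] that by (intro same) (auto intro: cong_trans cong_sym)
    then show ?thesis using n by (simp add: chi'_def)
  qed
  have "m > 0" using assms(2) modulus_pos by (auto intro: Nat.gr0I)
  have "dirichlet_character m chi'"
    unfolding dirichlet_character_def
  proof (intro conjI allI)
    fix n
    show "chi' (n + int m) = chi' n"
    proof (cases "coprime n (int m)")
      case True
      have "[lift n = n + int m] (mod int m)" using lift(2)[OF True] by (simp add: cong_def)
      then have "chi' (n + int m) = chi (lift n)" using lift(1)[OF True] by (intro chi'_eq)
      then show ?thesis using True by (simp add: chi'_def)
    next
      case False
      then show ?thesis by (simp add: chi'_def coprime_iff_gcd_eq_1)
    qed
    show "chi' n \<noteq> 0 \<longleftrightarrow> coprime n (int m)"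
      using lift(1)[of n] chi_eq_0_iff by (auto simp: chi'_def)
    fix k
    show "chi' (n * k) = chi' n * chi' k"
    proof (cases "coprime n (int m) \<and> coprime k (int m)")
      case True
      then have "chi' (n * k) = chi (lift n * lift k)"
        using lift[of n] lift[of k] by (intro chi'_eq cong_mult) auto
      then show ?thesis using True by (simp add: chi'_def chi_mult)
    next
      case False
      then show ?thesis by (auto simp: chi'_def)
    qed
  qed (rule \<open>m > 0\<close>)
  moreover have "chi n = chi' n" if "coprime n (int q)" for n
    using chi'_eq[OF that cong_refl] by simp
  ultimately have "conductor q chi \<le> m"
    unfolding conductor_def using assms(2) by (intro Least_le) auto
  then show False using assms by simp
qed

text \<open>If l is a unit, substitute l n for n. Otherwise let g = gcd (l, q) > 1: primitivity
  gives a unit u with u = 1 modulo q / g and \<open>chi u \<noteq> 1\<close>. Then l u = l modulo q,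
  so substituting u n multiplies the sum by \<open>cnj (chi u)\<close>; hence the sum is 0, as is
  \<open>chi l\<close>.\<close>

lemma primitive_gauss_sum_twist:
  assumes "conductor q chi = q"
  shows "(\<Sum>n\<in>{0..<int q}. cnj (chi n) * exp_2pii (of_int (l * n) / of_nat q)) =
    chi l * gauss_sum q (\<lambda>n. cnj (chi n))"
proof -
  define f where "f l n = cnj (chi n) * exp_2pii (of_int (l * n) / of_int (int q))" for l n
  have f_mod: "f l (n mod int q) = f l n" for l n
    unfolding f_def
    by (intro arg_cong2[of _ _ _ _ "(*)"] arg_cong[of _ _ cnj] chi_mod exp_2pii_cong)
       (use modulus_pos in \<open>auto simp: cong_def mod_mult_right_eq\<close>)
  have f_mult: "(\<Sum>n\<in>{0..<int q}. f l (u * n)) = (\<Sum>n\<in>{0..<int q}. f l n)" if "coprime u (int q)" for u l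
    using sum_mod_affine[of "int q" u "f l" 0] f_mod modulus_pos that by simp
  have "(\<Sum>n\<in>{0..<int q}. f l n) = chi l * (\<Sum>n\<in>{0..<int q}. f 1 n)"
  proof (cases "coprime l (int q)")
    case True
    have "(\<Sum>n\<in>{0..<int q}. f 1 n) = (\<Sum>n\<in>{0..<int q}. f 1 (l * n))"
      using f_mult[OF True] by simp
    also have "\<dots> = (\<Sum>n\<in>{0..<int q}. cnj (chi l) * f l n)"
      by (simp add: f_def chi_mult mult.assoc)
    finally have "chi l * (\<Sum>n\<in>{0..<int q}. f 1 n) = (chi l * cnj (chi l)) * (\<Sum>n\<in>{0..<int q}. f l n)"
      by (simp add: sum_distrib_left mult.assoc)
    also have "chi l * cnj (chi l) = 1"
      using norm_chi[OF True] by (simp add: complex_norm_square[symmetric])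
    finally show ?thesis by simp
  next
    case False
    define g where "g = gcd l (int q)"
    define m where "m = nat (int q div g)"
    have "g \<ge> 0" "g \<noteq> 0" "g \<noteq> 1" "g dvd int q"
      using False modulus_pos by (simp_all add: g_def coprime_iff_gcd_eq_1)
    then have g: "g > 1" by linarith
    then have "int m = int q div g"
      using modulus_pos by (simp add: m_def pos_imp_zdiv_nonneg_iff)
    then have gm: "g * int m = int q"
      using \<open>g dvd int q\<close> by simp
    then have "m < q" using modulus_pos g
      using mult_strict_right_mono[of 1 g "int m"] by (cases "m = 0") auto
    moreover have "int m dvd int q" using gm by (metis dvd_triv_right)
    ultimately obtain u where u: "coprime u (int q)" "[u = 1] (mod int m)" "chi u \<noteq> 1"
      using exists_coprime_chi_ne_1[OF assms] by blast
    have "[l * u = l] (mod int q)"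
    proof -
      obtain k where k: "u - 1 = int m * k" using u(2) by (metis cong_iff_dvd_diff dvdE)
      have "g dvd l" by (simp add: g_def)
      then obtain r where r: "l = g * r" ..
      have "l * u - l = (g * int m) * (r * k)" using k r by (simp add: algebra_simps)
      then show ?thesis unfolding gm by (metis cong_iff_dvd_diff dvd_triv_left)
    qed
    then have "exp_2pii (of_int (l * (u * n)) / of_int (int q)) = exp_2pii (of_int (l * n) / of_int (int q))" for n
      using modulus_pos cong_mult[OF _ cong_refl[of n], of "l * u" l "int q"]
      by (intro exp_2pii_cong) (simp_all add: mult.assoc)
    then have "(\<Sum>n\<in>{0..<int q}. f l (u * n)) = cnj (chi u) * (\<Sum>n\<in>{0..<int q}. f l n)"
      by (simp add: f_def chi_mult sum_distrib_left mult.assoc)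
    then have "(\<Sum>n\<in>{0..<int q}. f l n) = cnj (chi u) * (\<Sum>n\<in>{0..<int q}. f l n)"
      using f_mult[OF u(1)] by simp
    then have "(\<Sum>n\<in>{0..<int q}. f l n) = 0"
      using u(3) by (auto simp: complex_cnj_one_iff)
    moreover have "chi l = 0" using False chi_eq_0_iff by blast
    ultimately show ?thesis by simp
  qed
  then show ?thesis by (simp add: f_def gauss_sum_def)
qed

end

section \<open>Expansion of the Eisenstein series at a cusp\<close>

text \<open>For a, b >= 1 one has a + b \<le> 2 a b, so with \<open>s = sqrt (norm w)\<close> the
  terms are dominated by \<open>s ^ a * s ^ b\<close>, a product of two geometric series.\<close>

lemma abs_summable_power_mult:
  fixes w :: complex and A :: "nat set"
  assumes "norm w < 1" "0 \<notin> A"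
  shows "(\<lambda>p. norm (case p of (a, b) \<Rightarrow> w ^ (a * b))) summable_on A \<times> A"
proof -
  define s where "s = sqrt (norm w)"
  have s: "0 \<le> s" "s < 1" "s\<^sup>2 = norm w" using assms(1) by (simp_all add: s_def)
  have geo: "(\<lambda>n. s ^ n) summable_on A"
    using s by (intro summable_on_subset_banach[OF norm_summable_imp_summable_on]) auto
  have "(\<lambda>p. norm (case p of (a, b) \<Rightarrow> s ^ a * s ^ b)) summable_on A \<times> A"
    unfolding Infinite_Sum.abs_summable_on_Sigma_iff
  proof (intro conjI ballI)
    show "(\<lambda>y. norm (case (x, y) of (a, b) \<Rightarrow> s ^ a * s ^ b)) summable_on A" for x
      using s geo by (simp add: norm_mult norm_power summable_on_cmult_right)
    show "(\<lambda>x. norm (\<Sum>\<^sub>\<infinity>y\<in>A. norm (case (x, y) of (a, b) \<Rightarrow> s ^ a * s ^ b))) summable_on A"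
      using s geo by (simp add: norm_mult norm_power infsum_cmult_right' abs_mult summable_on_cmult_left infsum_nonneg)
  qed
  then show ?thesis
  proof (rule Infinite_Sum.abs_summable_on_comparison_test)
    fix p assume "p \<in> A \<times> A"
    then obtain a b where p: "p = (a, b)" "a \<in> A" "b \<in> A" by auto
    then have "a \<ge> 1" "b \<ge> 1" using assms(2) by (auto simp: Suc_le_eq intro: Nat.gr0I)
    then have "a * 1 \<le> a * b" "1 * b \<le> a * b" by (intro mult_le_mono; simp)+
    then have "a + b \<le> 2 * (a * b)" by linarith
    then have "s ^ (2 * (a * b)) \<le> s ^ (a + b)" using s by (intro power_decreasing) auto
    then show "norm (case p of (a, b) \<Rightarrow> w ^ (a * b)) \<le> norm (case p of (a, b) \<Rightarrow> s ^ a * s ^ b)"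
      using s by (simp add: p norm_power norm_mult power_mult power_add)
  qed
qed

text \<open>For a b = n the weight sqrt (b / a) / sqrt n equals 1 / a. The absolutely convergent
  double series may then be grouped by the product a b.\<close>

lemma eisenstein_q_series:
  fixes w :: complex
  assumes chi1: "dirichlet q1 chi1" and chi2: "dirichlet q2 chi2" and w: "norm w < 1"
  defines "h \<equiv> \<lambda>(a, b). chi1 (int a) * cnj (chi2 (int b)) / of_nat a * w ^ (a * b)"
  shows "h summable_on {1..} \<times> {1..}"
    and "(\<lambda>n. eisenstein_coeff chi1 chi2 (Suc n) / of_real (sqrt (real (Suc n))) * w ^ Suc n)
      sums infsum h ({1..} \<times> {1..})"
proof -
  have "(\<lambda>p. norm (h p)) summable_on {1..} \<times> {1..}"
  proof (rule Infinite_Sum.abs_summable_on_comparison_test)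
    show "(\<lambda>p. norm (case p of (a, b) \<Rightarrow> w ^ (a * b))) summable_on {1..} \<times> {1..}"
      by (rule abs_summable_power_mult[OF w]) simp
    fix p :: "nat \<times> nat" assume "p \<in> {1..} \<times> {1..}"
    then obtain a b where p: "p = (a, b)" "a \<ge> 1" by auto
    have "norm (chi1 (int a)) * norm (chi2 (int b)) / real a \<le> 1 * 1 / 1"
      using p(2) dirichlet.norm_chi_le[OF chi1] dirichlet.norm_chi_le[OF chi2]
      by (intro frac_le mult_mono) auto
    from mult_right_mono[OF this, of "norm (w ^ (a * b))"]
    show "norm (h p) \<le> norm (case p of (a, b) \<Rightarrow> w ^ (a * b))"
      by (simp add: p h_def norm_mult norm_divide)
  qed
  then show sm: "h summable_on {1..} \<times> {1..}" by (rule Infinite_Sum.abs_summable_summable)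
  define D where "D n = {(a, b). a * b = Suc n}" for n :: nat
  have fin: "finite (D n)" for n
  proof (rule finite_subset)
    show "D n \<subseteq> {..Suc n} \<times> {..Suc n}"
    proof clarify
      fix a b assume "(a, b) \<in> D n"
      then have "a dvd Suc n" "b dvd Suc n" unfolding D_def by (metis (lifting) case_prodD dvd_triv_left dvd_triv_right mem_Collect_eq)+
      then show "a \<in> {..Suc n} \<and> b \<in> {..Suc n}" by (auto dest: dvd_imp_le)
    qed
  qed auto
  have pos: "0 < a \<and> 0 < b" if "a * b = Suc n" for a b n :: nat
    using that by (cases a; cases b) auto
  have "(h has_sum infsum h ({1..} \<times> {1..})) ({1..} \<times> {1..})"
    using sm by (rule has_sum_infsum)
  \<comment> \<open>The group index is a b - 1, since the series of \<open>eisenstein_f\<close>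
    starts at \<open>Suc 0\<close>.\<close>
  also have "?this \<longleftrightarrow> ((\<lambda>(n, p). h p) has_sum infsum h ({1..} \<times> {1..})) (Sigma UNIV D)"
    by (rule has_sum_reindex_bij_witness[where i = snd and j = "\<lambda>(a, b). (a * b - 1, (a, b))"])
       (auto simp: D_def Suc_le_eq dest: pos)
  finally have "((\<lambda>n. \<Sum>p\<in>D n. h p) has_sum infsum h ({1..} \<times> {1..})) UNIV"
    by (rule has_sum_SigmaD) (auto intro!: has_sum_finiteI fin)
  then have "(\<lambda>n. \<Sum>p\<in>D n. h p) sums infsum h ({1..} \<times> {1..})" by (rule has_sum_imp_sums)
  moreover have "(\<Sum>p\<in>D n. h p) = eisenstein_coeff chi1 chi2 (Suc n) / of_real (sqrt (real (Suc n))) * w ^ Suc n" for n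
  proof -
    have eq: "h (a, b) = chi1 (int a) * cnj (chi2 (int b)) * of_real (sqrt (real b / real a)) *
        (w ^ Suc n / of_real (sqrt (real (Suc n))))" if "(a, b) \<in> D n" for a b
    proof -
      have ab: "a * b = Suc n" using that by (simp add: D_def)
      then have "a > 0" "b > 0" using pos by blast+
      moreover have "real (Suc n) = real a * real b" using ab by (metis of_nat_mult)
      ultimately have "1 / real a = sqrt (real b / real a) / sqrt (real (Suc n))"
        by (simp add: real_sqrt_divide real_sqrt_mult field_simps del: of_nat_Suc)
      then have e: "1 / (of_nat a :: complex) = of_real (sqrt (real b / real a)) / of_real (sqrt (real (Suc n)))"
        by (metis of_real_1 of_real_divide of_real_of_nat_eq)
      have "h (a, b) = chi1 (int a) * cnj (chi2 (int b)) * w ^ Suc n * (1 / of_nat a)"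
        by (simp add: h_def ab)
      then show ?thesis unfolding e by (simp only: times_divide_eq_right times_divide_eq_left mult_ac)
    qed
    have "(\<Sum>p\<in>D n. h p) = (\<Sum>(a, b)\<in>D n. chi1 (int a) * cnj (chi2 (int b)) * of_real (sqrt (real b / real a)) *
        (w ^ Suc n / of_real (sqrt (real (Suc n)))))"
      by (rule sum.cong) (auto simp: eq)
    also have "\<dots> = (\<Sum>(a, b)\<in>D n. chi1 (int a) * cnj (chi2 (int b)) * of_real (sqrt (real b / real a))) *
        (w ^ Suc n / of_real (sqrt (real (Suc n))))"
      by (simp only: sum_distrib_right case_prod_unfold)
    finally show ?thesis
      using dirichlet.chi_1[OF chi2] by (simp add: eisenstein_coeff_def D_def del: of_nat_Suc)
  qed
  ultimately show "(\<lambda>n. eisenstein_coeff chi1 chi2 (Suc n) / of_real (sqrt (real (Suc n))) * w ^ Suc n)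
      sums infsum h ({1..} \<times> {1..})" by simp
qed

section \<open>The Eisenstein series as a function on the upper half-plane\<close>

lemma exp_2pii_of_nat_mult: "exp_2pii (of_nat n * z) = exp_2pii z ^ n"
  by (simp add: exp_2pii_def exp_of_nat_mult[symmetric] mult_ac)

lemma norm_exp_2pii: "norm (exp_2pii z) = exp (- 2 * pi * Im z)"
  by (simp add: exp_2pii_def)

lemma eisenstein_f_eq_infsum:
  assumes "dirichlet q1 chi1" "dirichlet q2 chi2" "Im z > 0"
  shows "eisenstein_f chi1 chi2 z =
    (\<Sum>\<^sub>\<infinity>(a, b)\<in>{1..} \<times> {1..}. chi1 (int a) * cnj (chi2 (int b)) / of_nat a * exp_2pii z ^ (a * b))"
  unfolding eisenstein_f_def exp_2pii_of_nat_mult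
  using eisenstein_q_series(2)[OF assms(1,2), of "exp_2pii z"] assms(3)
  by (intro sums_unique[symmetric]) (simp add: norm_exp_2pii)

text \<open>The function is a power series on the unit disc composed with \<open>exp_2pii\<close>;
  \<open>c 0 = 0\<close> supplies its constant term.\<close>

lemma eisenstein_f_holomorphic:
  assumes "dirichlet q1 chi1" "dirichlet q2 chi2"
  shows "eisenstein_f chi1 chi2 holomorphic_on upper_half_plane"
proof -
  define c where "c n = (if n = 0 then 0 else eisenstein_coeff chi1 chi2 n / of_real (sqrt (real n)))" for n
  define F where "F w = (\<Sum>n. c (Suc n) * w ^ Suc n)" for w :: complex
  have "(\<lambda>n. c n * (w - 0) ^ n) sums F w" if "w \<in> ball 0 1" for w
  proof -
    have "summable (\<lambda>n. c (Suc n) * w ^ Suc n)"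
      using eisenstein_q_series(2)[OF assms, of w] that by (auto simp: c_def sums_iff)
    then have "(\<lambda>n. c (Suc n) * w ^ Suc n) sums F w" by (simp add: F_def summable_sums)
    then show ?thesis by (subst (asm) sums_Suc_iff) (simp add: c_def)
  qed
  then have "F holomorphic_on ball 0 1" by (rule power_series_holomorphic)
  then have "(F \<circ> exp_2pii) holomorphic_on upper_half_plane"
    unfolding exp_2pii_def
    by (intro holomorphic_on_compose_gen[of _ _ F "ball 0 1"] holomorphic_intros)
       (auto simp: upper_half_plane_def)
  moreover have "F \<circ> exp_2pii = eisenstein_f chi1 chi2"
    by (simp add: fun_eq_iff F_def eisenstein_f_def c_def exp_2pii_of_nat_mult del: of_nat_Suc power_Suc)
  ultimately show ?thesis by simp
qed

text \<open>Summing in blocks of length c, each residue r contributes a geometric series of ratio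
  \<open>w ^ c\<close>.\<close>

lemma sums_periodic_mult_power:
  fixes g :: "nat \<Rightarrow> complex"
  assumes "c > 0" "norm w < 1" "\<And>b. g (b + c) = g b" "(\<lambda>b. g b * w ^ b) sums S"
  shows "S = (\<Sum>r<c. g r * (w ^ r / (1 - w ^ c)))"
proof -
  have per: "g (r + c * n) = g r" for n r
  proof (induction n)
    case (Suc n)
    have "g (r + c * Suc n) = g ((r + c * n) + c)" by (simp add: algebra_simps)
    then show ?case by (simp only: assms(3) Suc)
  qed simp
  have "(\<lambda>n. \<Sum>b\<in>{n * c..<n * c + c}. g b * w ^ b) sums S"
    using assms by (intro sums_group) auto
  moreover have "(\<Sum>b\<in>{n * c..<n * c + c}. g b * w ^ b) = (\<Sum>r<c. g r * (w ^ r * (w ^ c) ^ n))" for n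
    using sum.shift_bounds_nat_ivl[of "\<lambda>b. g b * w ^ b" 0 "n * c" c]
    by (simp add: per add.commute power_add power_mult[symmetric] mult_ac lessThan_atLeast0)
  ultimately have "(\<lambda>n. \<Sum>r<c. g r * (w ^ r * (w ^ c) ^ n)) sums S" by simp
  moreover have "(\<lambda>n. \<Sum>r<c. g r * (w ^ r * (w ^ c) ^ n)) sums (\<Sum>r<c. g r * (w ^ r * (1 / (1 - w ^ c))))"
  proof -
    have "norm (w ^ c) < 1" using assms by (simp add: norm_power power_less_one_iff)
    then show ?thesis by (intro sums_sum sums_mult geometric_sums)
  qed
  ultimately show ?thesis by (simp add: sums_unique2)
qed

text \<open>Fix the first summation index l and sum over the second one, b. As q2 divides c,
  \<open>chi2 b\<close> depends only on b modulo c, so the sum is geometric on each class r, and its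
  value is a kernel at r / c. Absolute convergence justifies the iterated summation.\<close>

lemma eisenstein_f_cusp_expansion:
  fixes x0 c :: int and s :: real
  assumes chi1: "dirichlet q1 chi1" and chi2: "dirichlet q2 chi2" and q2: "q2 > 1"
    and c: "c > 0" "int q2 dvd c" and s: "s > 0"
  shows "(\<lambda>N. \<Sum>l\<in>{1..N}. chi1 (int l) / of_nat l * (\<Sum>r\<in>{0..<c}. cnj (chi2 r) *
      (exp_2pii (of_int (int l * (r * x0)) / of_int c) * bernoulli_kernel (of_int r / of_int c) (- 2 * pi * l * s))))
    \<longlonglongrightarrow> eisenstein_f chi1 chi2 (Complex (of_int x0 / of_int c) (s / of_int c))"
proof -
  define z where "z = Complex (of_int x0 / of_int c) (s / of_int c)"
  define w where "w = exp_2pii z"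
  have z: "Im z > 0" using c s by (simp add: z_def)
  have w: "norm w < 1" using z by (simp add: w_def norm_exp_2pii)
  define h where "h = (\<lambda>(a, b). chi1 (int a) * cnj (chi2 (int b)) / of_nat a * w ^ (a * b))"
  define G where "G l = (\<Sum>r\<in>{0..<c}. cnj (chi2 r) *
      (exp_2pii (of_int (int l * (r * x0)) / of_int c) * bernoulli_kernel (of_int r / of_int c) (- 2 * pi * l * s)))" for l :: nat
  have sm: "h summable_on {1..} \<times> {1..}"
    unfolding h_def by (rule eisenstein_q_series(1)[OF chi1 chi2 w])
  \<comment> \<open>This allows b = 0 to be included, so that b runs over complete periods.\<close>
  have chi2_0: "chi2 0 = 0"
    using dirichlet.chi_eq_0_iff[OF chi2, of 0] q2 by simp
  have inner: "((\<lambda>b. h (l, b)) has_sum (chi1 (int l) / of_nat l * G l)) {1..}" if l: "l \<in> {1..}" for l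
  proof -
    have "(\<lambda>b. norm (w ^ (l * b))) summable_on UNIV"
    proof -
      have "norm (w ^ l) < 1" using w l by (simp add: norm_power power_less_one_iff)
      then show ?thesis
        by (intro norm_summable_imp_summable_on) (simp add: norm_power power_mult summable_geometric)
    qed
    then have "(\<lambda>b. norm (cnj (chi2 (int b)) * w ^ (l * b))) summable_on UNIV"
      by (rule Infinite_Sum.abs_summable_on_comparison_test)
         (simp add: norm_mult mult_left_le_one_le dirichlet.norm_chi_le[OF chi2])
    then have hs: "((\<lambda>b. cnj (chi2 (int b)) * (w ^ l) ^ b) has_sum (\<Sum>\<^sub>\<infinity>b. cnj (chi2 (int b)) * (w ^ l) ^ b)) UNIV"
      unfolding power_mult by (rule has_sum_infsum[OF Infinite_Sum.abs_summable_summable])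
    have "(\<Sum>\<^sub>\<infinity>b. cnj (chi2 (int b)) * (w ^ l) ^ b) =
        (\<Sum>r<nat c. cnj (chi2 (int r)) * ((w ^ l) ^ r / (1 - (w ^ l) ^ nat c)))"
    proof (rule sums_periodic_mult_power[OF _ _ _ has_sum_imp_sums[OF hs]])
      show "norm (w ^ l) < 1" using w l by (simp add: norm_power power_less_one_iff)
      fix b
      obtain k where "c = int q2 * k" using c(2) ..
      then show "cnj (chi2 (int (b + nat c))) = cnj (chi2 (int b))"
        using dirichlet.chi_add_mult[OF chi2, of "int b" k] c(1) by (simp add: mult.commute)
    qed (use c in auto)
    also have "\<dots> = (\<Sum>r\<in>{0..<c}. cnj (chi2 r) * ((w ^ l) ^ nat r / (1 - (w ^ l) ^ nat c)))"
      by (rule sum.reindex_bij_witness[of _ nat int]) (use c(1) in auto)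
    also have "\<dots> = G l"
      unfolding G_def
    proof (intro sum.cong refl arg_cong2[of _ _ _ _ "(*)"])
      fix r assume r: "r \<in> {0..<c}"
      have pw: "(w ^ l) ^ nat k = exp_2pii (of_int (int l * (k * x0)) / of_int c) *
          exp (of_real (of_int k / of_int c) * complex_of_real (- 2 * pi * l * s))" if "k \<ge> 0" for k
      proof -
        have zc: "z = of_int x0 / of_int c + \<i> * (of_real s / of_int c)"
          by (simp add: z_def complex_eq_iff)
        have "(w ^ l) ^ nat k = exp_2pii (of_nat (l * nat k) * z)"
          by (simp only: w_def exp_2pii_of_nat_mult power_mult)
        also have "of_nat (l * nat k) = (of_int (int l * k) :: complex)"
          using that by (metis int_nat_eq of_int_of_nat_eq of_nat_mult)
        also have "exp_2pii (of_int (int l * k) * z) =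
            exp_2pii (of_int (int l * (k * x0)) / of_int c + \<i> * of_real (of_int (int l * k) * s / of_int c))"
          by (simp add: zc algebra_simps)
        also have "\<dots> = exp_2pii (of_int (int l * (k * x0)) / of_int c) *
            exp_2pii (\<i> * of_real (of_int (int l * k) * s / of_int c))"
          by (rule exp_2pii_add)
        also have "exp_2pii (\<i> * of_real (of_int (int l * k) * s / of_int c)) =
            exp (of_real (of_int k / of_int c) * complex_of_real (- 2 * pi * l * s))"
          unfolding exp_2pii_def by (rule arg_cong[of _ _ exp]) (simp add: field_simps)
        finally show ?thesis .
      qed
      \<comment> \<open>At k = c the factor \<open>exp_2pii (of_int (int l * x0))\<close> is 1, so
        the geometric ratio is real and matches the denominator of the kernel.\<close>
      have "(w ^ l) ^ nat c = exp (complex_of_real (- 2 * pi * l * s))"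
        using pw[of c] c(1) exp_2pii_of_int[of "int l * x0"] by (simp add: mult.assoc mult.commute mult.left_commute)
      then show "(w ^ l) ^ nat r / (1 - (w ^ l) ^ nat c) = exp_2pii (of_int (int l * (r * x0)) / of_int c) *
          bernoulli_kernel (of_int r / of_int c) (- 2 * pi * l * s)"
        using pw[of r] r by (simp add: bernoulli_kernel_def)
    qed
    finally have "((\<lambda>b. cnj (chi2 (int b)) * (w ^ l) ^ b) has_sum G l) UNIV" using hs by simp
    then have "((\<lambda>b. cnj (chi2 (int b)) * (w ^ l) ^ b) has_sum G l) {1..}"
      by (rule has_sum_cong_neutral[THEN iffD1, rotated 3])
         (auto simp: chi2_0 not_le)
    from has_sum_cmult_right[OF this, of "chi1 (int l) / of_nat l"]
    show ?thesis by (simp add: h_def power_mult mult_ac)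
  qed
  have "((\<lambda>l. chi1 (int l) / of_nat l * G l) has_sum infsum h ({1..} \<times> {1..})) {1..}"
    using has_sum_SigmaD[OF has_sum_infsum[OF sm] inner] .
  then have "((\<lambda>l. chi1 (int (Suc l)) / of_nat (Suc l) * G (Suc l)) has_sum infsum h ({1..} \<times> {1..})) UNIV"
    using has_sum_reindex_bij_betw[of Suc UNIV "{1..}" "\<lambda>l. chi1 (int l) / of_nat l * G l"]
      bij_betwI[of Suc UNIV "{1..}" "\<lambda>l. l - 1"] by simp
  then have "(\<lambda>N. \<Sum>l<N. chi1 (int (Suc l)) / of_nat (Suc l) * G (Suc l)) \<longlonglongrightarrow> infsum h ({1..} \<times> {1..})"
    using has_sum_imp_sums unfolding sums_def by blast
  moreover have "(\<Sum>l<N. chi1 (int (Suc l)) / of_nat (Suc l) * G (Suc l)) = (\<Sum>l\<in>{1..N}. chi1 (int l) / of_nat l * G l)" for N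
    by (rule sum.reindex_bij_witness[of _ "\<lambda>l. l - 1" Suc]) auto
  moreover have "infsum h ({1..} \<times> {1..}) = eisenstein_f chi1 chi2 z"
    unfolding eisenstein_f_eq_infsum[OF chi1 chi2 z] h_def w_def ..
  ultimately show ?thesis by (simp add: z_def G_def)
qed

section \<open>The Dedekind sum\<close>

text \<open>Here c' is c / q1, which puts n / q1 + a j / c over the common denominator c, with
  numerator c' n + a j.\<close>

locale dedekind_data = chi1: dirichlet q1 chi1 + chi2: dirichlet q2 chi2
  for q1 q2 :: nat and chi1 chi2 :: "int \<Rightarrow> complex" +
  fixes a b c d c' :: int
  assumes primitive: "conductor q1 chi1 = q1"
    and q1: "q1 > 1" and q2: "q2 > 1"
    and parity: "chi1 (-1) * chi2 (-1) = 1"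
    and c: "c > 0" and c_eq: "c = int q1 * c'" and q2_dvd: "int q2 dvd c'"
    and det: "a * d - b * c = 1"
begin

text \<open>
  For \<open>C j n \<noteq> 0\<close>, \<open>X j n\<close> and \<open>Y j\<close> are the fractional parts of \<open>n / q1 + a j / c\<close> and \<open>j / c\<close>,
  and both are nonzero.
\<close>

definition C :: "int \<Rightarrow> int \<Rightarrow> complex" where "C j n = cnj (chi2 j) * cnj (chi1 n)"
definition X :: "int \<Rightarrow> int \<Rightarrow> real" where "X j n = of_int ((c' * n + a * j) mod c) / of_int c"
definition Y :: "int \<Rightarrow> real" where "Y j = of_int (j mod c) / of_int c"
definition \<tau> :: complex where "\<tau> = gauss_sum q1 (\<lambda>n. cnj (chi1 n))"
definition \<psi> :: complex where "\<psi> = chi1 d * cnj (chi2 d)"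

section \<open>The weights \<open>C\<close> and the fractional parts \<open>X\<close> and
  \<open>Y\<close>\<close>

lemma q2_dvd_c: "int q2 dvd c" and q1_dvd_c: "int q1 dvd c"
  using q2_dvd by (simp_all add: c_eq)

lemma ad_cong: "[a * d = 1] (mod c)"
proof -
  have "a * d - 1 = c * b" using det by (simp add: algebra_simps)
  then show ?thesis by (simp add: cong_iff_dvd_diff)
qed

lemma c'_nonzero: "c' \<noteq> 0"
  using c c_eq by auto

lemma coprime_ac: "coprime a c" and coprime_dc: "coprime d c"
  using ad_cong coprime_iff_invertible_int by (blast, metis mult.commute coprime_iff_invertible_int)

lemma chi_zero: "chi1 0 = 0" "chi2 0 = 0"
  using chi1.chi_eq_0_iff[of 0] chi2.chi_eq_0_iff[of 0] q1 q2 by simp_all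

lemma C_periodic: "C (j mod c) n = C j n" "C j (n mod int q1) = C j n"
  using chi2.chi_mod[OF q2_dvd_c] chi1.chi_mod[OF dvd_refl] by (simp_all add: C_def)

text \<open>The parity hypothesis enters here: changing both signs multiplies \<open>C\<close> by
  the conjugate of \<open>chi1 (-1) * chi2 (-1)\<close>.\<close>

lemma C_minus: "C (-j) (-n) = C j n"
proof -
  have "chi2 (-1) * chi2 (-1) = 1"
    using chi2.chi_mult[of "-1" "-1"] chi2.chi_1 by simp
  then have "chi2 (-1) = 1 \<or> chi2 (-1) = -1"
    by (simp add: square_eq_1_iff)
  then have "cnj (chi2 (-1)) * cnj (chi1 (-1)) = 1"
    using parity by (metis complex_cnj_mult complex_cnj_one mult.commute)
  moreover have "chi2 (-j) = chi2 (-1) * chi2 j" "chi1 (-n) = chi1 (-1) * chi1 n"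
    using chi2.chi_mult[of "-1" j] chi1.chi_mult[of "-1" n] by simp_all
  ultimately show ?thesis by (simp add: C_def)
qed

text \<open>Negation permutes the residues modulo c and modulo q1, and \<open>C_minus\<close> keeps
  the weight.\<close>

lemma sum_C_minus:
  fixes f :: "int \<Rightarrow> int \<Rightarrow> complex"
  assumes "\<And>j n. f (j mod c) n = f j n" "\<And>j n. f j (n mod int q1) = f j n"
  shows "(\<Sum>j\<in>{0..<c}. \<Sum>n\<in>{0..<int q1}. C j n * f (-j) (-n)) =
    (\<Sum>j\<in>{0..<c}. \<Sum>n\<in>{0..<int q1}. C j n * f j n)"
proof -
  have "(\<Sum>n\<in>{0..<int q1}. C j n * f (-j) (-n)) = (\<Sum>n\<in>{0..<int q1}. C (-j) n * f (-j) n)" for j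
    using sum_mod_affine[of "int q1" "-1" "\<lambda>n. C (-j) n * f (-j) n" 0] chi1.modulus_pos
    by (simp add: C_periodic assms C_minus)
  moreover have "(\<Sum>j\<in>{0..<c}. \<Sum>n\<in>{0..<int q1}. C (-j) n * f (-j) n) =
      (\<Sum>j\<in>{0..<c}. \<Sum>n\<in>{0..<int q1}. C j n * f j n)"
    using sum_mod_affine[of c "-1" "\<lambda>j. \<Sum>n\<in>{0..<int q1}. C j n * f j n" 0] c
    by (simp add: C_periodic assms)
  ultimately show ?thesis by simp
qed

text \<open>A nonzero weight makes j coprime to q2 > 1. Modulo q2, which divides both c and c', the
  second number is a j with a a unit, so neither number is 0. This keeps \<open>X\<close> and
  \<open>Y\<close> off the endpoint 0, where the kernel formula fails.\<close>

lemma C_nonzero: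
  assumes "C j n \<noteq> 0"
  shows "j mod c \<noteq> 0" "(c' * n + a * j) mod c \<noteq> 0"
proof -
  have j: "coprime j (int q2)" using assms by (simp add: C_def chi2.chi_eq_0_iff)
  have nd: "\<not> int q2 dvd j"
  proof
    assume "int q2 dvd j"
    then have "int q2 dvd 1" using j by (metis coprime_common_divisor dvd_refl)
    then show False using q2 by simp
  qed
  then show "j mod c \<noteq> 0" using q2_dvd_c by (meson dvd_trans mod_0_imp_dvd)
  have cop: "coprime (int q2) a" using coprime_ac q2_dvd_c by (metis coprime_commute coprime_divisors dvd_refl)
  show "(c' * n + a * j) mod c \<noteq> 0"
  proof
    assume "(c' * n + a * j) mod c = 0"
    then have "int q2 dvd c' * n + a * j" using q2_dvd_c by (meson dvd_trans mod_0_imp_dvd)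
    then have "int q2 dvd a * j" using q2_dvd by (simp add: dvd_add_right_iff)
    then show False using nd cop by (simp add: coprime_dvd_mult_right_iff)
  qed
qed

lemma C_nonzero_range:
  assumes "C j n \<noteq> 0"
  shows "0 < X j n" "X j n < 1" "0 < Y j" "Y j < 1"
    and "X (-j) (-n) = 1 - X j n" "Y (-j) = 1 - Y j"
proof -
  have *: "0 < m mod c" "m mod c < c" "(- m) mod c = c - m mod c" if "m mod c \<noteq> 0" for m
    using that pos_mod_sign[OF c, of m] pos_mod_bound[OF c, of m]
    by (simp_all add: zmod_zminus1_eq_if order_less_le)
  have neg: "c' * - n + a * - j = - (c' * n + a * j)" by simp
  show "0 < X j n" "X j n < 1" "0 < Y j" "Y j < 1"
      "X (-j) (-n) = 1 - X j n" "Y (-j) = 1 - Y j"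
    unfolding X_def Y_def neg
    using *[OF C_nonzero(1)[OF assms]] *[OF C_nonzero(2)[OF assms]] c
    by (simp_all add: field_simps)
qed

lemma X_periodic: "X (j mod c) n = X j n" "X j (n mod int q1) = X j n"
proof -
  have "(c' * n + a * (j mod c)) mod c = (c' * n + a * j) mod c"
    by (metis mod_add_right_eq mod_mult_right_eq)
  then show "X (j mod c) n = X j n" by (simp add: X_def)
  have "[c' * (n mod int q1) = c' * n] (mod (c' * int q1))"
    by (metis cong_def mod_mult_mult1 mod_mod_trivial)
  then have "[c' * (n mod int q1) + a * j = c' * n + a * j] (mod c)"
    unfolding c_eq by (simp add: cong_add_rcancel mult.commute)
  then show "X j (n mod int q1) = X j n" by (simp add: X_def cong_def)
qed

lemma Y_periodic: "Y (j mod c) = Y j"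
  by (simp add: Y_def)

text \<open>\<open>exp_2pii\<close> has period 1, so after multiplication by the integer l the
  fractional part may be replaced by n / q1 + a j / c itself, which separates n from j.\<close>

lemma exp_mult_X:
  "exp_2pii (of_real (real l * X j n)) =
    exp_2pii (of_int (int l * n) / of_nat q1) * exp_2pii (of_int (int l * (j * a)) / of_int c)"
proof -
  have "exp_2pii (of_real (real l * X j n)) = exp_2pii (of_int (int l * ((c' * n + a * j) mod c)) / of_int c)"
    by (simp add: X_def)
  also have "\<dots> = exp_2pii (of_int (int l * (c' * n + a * j)) / of_int c)"
    using c by (intro exp_2pii_cong cong_mult) (simp_all add: cong_def)
  also have "of_int (int l * (c' * n + a * j)) / of_int c =
      (of_int (int l * n) / of_nat q1 + of_int (int l * (j * a)) / of_int c :: complex)"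
    using c'_nonzero q1 unfolding c_eq by (auto simp: field_simps)
  finally show ?thesis by (simp add: exp_2pii_add)
qed

lemma exp_mult_minus_Y:
  "exp_2pii (- of_real (real l * Y j)) = exp_2pii (of_int (int l * - j) / of_int c)"
proof -
  have "exp_2pii (- of_real (real l * Y j)) = exp_2pii (of_int (int l * - (j mod c)) / of_int c)"
    by (simp add: Y_def)
  also have "\<dots> = exp_2pii (of_int (int l * - j) / of_int c)"
    using c by (intro exp_2pii_cong cong_mult) (auto simp: cong_def mod_minus_eq)
  finally show ?thesis .
qed

section \<open>Weighted sums over j and n\<close>

lemma gauss_twist: "(\<Sum>n\<in>{0..<int q1}. cnj (chi1 n) * exp_2pii (of_int (l * n) / of_nat q1)) = chi1 l * \<tau>"
  unfolding \<tau>_def by (rule chi1.primitive_gauss_sum_twist[OF primitive])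

text \<open>This is the twisted Gauss sum at l = 0.\<close>

lemma sum_chi1: "(\<Sum>n\<in>{0..<int q1}. cnj (chi1 n)) = 0"
  using gauss_twist[of 0] chi_zero exp_2pii_of_int[of 0] by simp

text \<open>By \<open>exp_mult_X\<close> the variable n occurs only in \<open>chi1\<close> and one
  exponential, so the inner sum is a twisted Gauss sum.\<close>

lemma sum_C_X:
  "(\<Sum>j\<in>{0..<c}. \<Sum>n\<in>{0..<int q1}. C j n * (exp_2pii (of_real (real l * X j n)) * f (Y j))) =
    \<tau> * chi1 (int l) * (\<Sum>r\<in>{0..<c}. cnj (chi2 r) *
      (exp_2pii (of_int (int l * (r * a)) / of_int c) * f (of_int r / of_int c)))"
proof -
  have "(\<Sum>n\<in>{0..<int q1}. C j n * (exp_2pii (of_real (real l * X j n)) * f (Y j))) =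
      \<tau> * chi1 (int l) * (cnj (chi2 j) * (exp_2pii (of_int (int l * (j * a)) / of_int c) * f (Y j)))" for j
  proof -
    have "(\<Sum>n\<in>{0..<int q1}. C j n * (exp_2pii (of_real (real l * X j n)) * f (Y j))) =
       (\<Sum>n\<in>{0..<int q1}. (cnj (chi1 n) * exp_2pii (of_int (int l * n) / of_nat q1)) *
         (cnj (chi2 j) * (exp_2pii (of_int (int l * (j * a)) / of_int c) * f (Y j))))"
      unfolding exp_mult_X C_def by (simp only: mult_ac)
    then show ?thesis
      unfolding sum_distrib_right[symmetric] gauss_twist by (simp only: mult_ac)
  qed
  then show ?thesis
    unfolding sum_distrib_left by (intro sum.cong refl) (simp only: Y_def, simp)
qed

text \<open>
  The substitution \<open>j = d (r - c' n)\<close>, which inverts \<open>r = c' n + a j\<close> modulo \<open>c\<close>.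
\<close>

lemma sum_C_reindex:
  fixes f g :: "int \<Rightarrow> complex"
  assumes "\<And>j. g (j mod c) = g j"
  shows "(\<Sum>j\<in>{0..<c}. \<Sum>n\<in>{0..<int q1}. C j n * (g j * f ((c' * n + a * j) mod c))) =
    cnj (chi2 d) * (\<Sum>r\<in>{0..<c}. cnj (chi2 r) * f r * (\<Sum>n\<in>{0..<int q1}. cnj (chi1 n) * g (d * r - d * c' * n)))"
proof -
  have "(\<Sum>j\<in>{0..<c}. C j n * (g j * f ((c' * n + a * j) mod c))) =
    (\<Sum>r\<in>{0..<c}. cnj (chi2 d) * (cnj (chi2 r) * f r * (cnj (chi1 n) * g (d * r - d * c' * n))))" for n
  proof -
    have "(\<Sum>j\<in>{0..<c}. C j n * (g j * f ((c' * n + a * j) mod c))) =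
      (\<Sum>r\<in>{0..<c}. C (d * r + - (d * c' * n)) n * (g (d * r + - (d * c' * n)) *
        f ((c' * n + a * (d * r + - (d * c' * n))) mod c)))"
      using coprime_dc c assms
      by (subst sum_mod_affine[of c d "\<lambda>j. C j n * (g j * f ((c' * n + a * j) mod c))" "- (d * c' * n)"])
         (simp_all add: C_periodic, metis mod_add_right_eq mod_mult_right_eq)
    also have "\<dots> = (\<Sum>r\<in>{0..<c}. cnj (chi2 d) * (cnj (chi2 r) * f r * (cnj (chi1 n) * g (d * r - d * c' * n))))"
    proof (rule sum.cong[OF refl])
      fix r assume r: "r \<in> {0..<c}"
      \<comment> \<open>Since q2 divides c', the shift by d c' n is invisible to
        \<open>chi2\<close>.\<close>
      have "[d * r + - (d * c' * n) = d * r] (mod int q2)"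
        using q2_dvd by (auto simp: cong_iff_dvd_diff)
      then have "chi2 (d * r + - (d * c' * n)) = chi2 d * chi2 r"
        using chi2.chi_cong chi2.chi_mult by metis
      moreover have "(c' * n + a * (d * r + - (d * c' * n))) mod c = r"
      proof -
        have "[c' * n + (a * d) * (r - c' * n) = c' * n + 1 * (r - c' * n)] (mod c)"
          by (intro cong_add cong_mult cong_refl ad_cong)
        then have "[c' * n + a * (d * r + - (d * c' * n)) = r] (mod c)"
          by (simp add: algebra_simps)
        then show ?thesis using r by (simp add: cong_def)
      qed
      ultimately show "C (d * r + - (d * c' * n)) n * (g (d * r + - (d * c' * n)) *
        f ((c' * n + a * (d * r + - (d * c' * n))) mod c)) =
        cnj (chi2 d) * (cnj (chi2 r) * f r * (cnj (chi1 n) * g (d * r - d * c' * n)))"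
        by (simp add: C_def)
    qed
    finally show ?thesis .
  qed
  then show ?thesis
    by (subst sum.swap) (simp add: sum_distrib_left sum.swap[of _ "{0..<int q1}" "{0..<c}"])
qed

text \<open>After \<open>sum_C_reindex\<close>, the exponential of -l j / c splits into those of -l
  d r / c and l d n / q1. The Gauss sum over n yields \<open>chi1 d\<close>, the reindexing yields
  \<open>cnj (chi2 d)\<close>, and together they are \<psi>.\<close>

lemma sum_C_Y:
  "(\<Sum>j\<in>{0..<c}. \<Sum>n\<in>{0..<int q1}. C j n * (exp_2pii (- of_real (real l * Y j)) * f (X j n))) =
    \<tau> * \<psi> * chi1 (int l) * (\<Sum>r\<in>{0..<c}. cnj (chi2 r) *
      (exp_2pii (of_int (int l * (r * - d)) / of_int c) * f (of_int r / of_int c)))"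
proof -
  define g where "g j = exp_2pii (of_int (int l * - j) / of_int c)" for j
  have g_mod: "g (j mod c) = g j" for j
    unfolding g_def using c
    by (intro exp_2pii_cong cong_mult) (auto simp: cong_def mod_minus_eq)
  have g: "g (d * r - d * c' * n) =
      exp_2pii (of_int (int l * (r * - d)) / of_int c) * exp_2pii (of_int ((int l * d) * n) / of_nat q1)" for r n
  proof -
    have "of_int (int l * - (d * r - d * c' * n)) / of_int c =
        (of_int (int l * (r * - d)) / of_int c + of_int ((int l * d) * n) / of_nat q1 :: complex)"
      using c'_nonzero q1 unfolding c_eq by (auto simp: field_simps)
    then show ?thesis by (simp only: g_def exp_2pii_add)
  qed
  have twist: "(\<Sum>n\<in>{0..<int q1}. cnj (chi1 n) * g (d * r - d * c' * n)) =
      exp_2pii (of_int (int l * (r * - d)) / of_int c) * (chi1 (int l) * chi1 d * \<tau>)" for r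
    unfolding chi1.chi_mult[symmetric] gauss_twist[symmetric] g sum_distrib_left by (simp only: mult_ac)
  have "(\<Sum>j\<in>{0..<c}. \<Sum>n\<in>{0..<int q1}. C j n * (exp_2pii (- of_real (real l * Y j)) * f (X j n))) =
      (\<Sum>j\<in>{0..<c}. \<Sum>n\<in>{0..<int q1}. C j n * (g j * f (of_int ((c' * n + a * j) mod c) / of_int c)))"
    by (simp only: exp_mult_minus_Y g_def X_def)
  also have "\<dots> = cnj (chi2 d) * (\<Sum>r\<in>{0..<c}. cnj (chi2 r) * f (of_int r / of_int c) *
      (\<Sum>n\<in>{0..<int q1}. cnj (chi1 n) * g (d * r - d * c' * n)))"
    by (rule sum_C_reindex[of g "\<lambda>m. f (of_int m / of_int c)", OF g_mod])
  finally show ?thesis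
    unfolding twist by (simp add: \<psi>_def sum_distrib_left mult_ac)
qed

text \<open>After reindexing, n occurs only in \<open>chi1\<close>, whose conjugates sum to 0. This
  and the next lemma remove \<open>g\<close> and \<open>h\<close> of the reciprocity.\<close>

lemma sum_C_fun_X: "(\<Sum>j\<in>{0..<c}. \<Sum>n\<in>{0..<int q1}. C j n * f (X j n)) = 0"
  using sum_C_reindex[of "\<lambda>_. 1" "\<lambda>m. f (of_int m / of_int c)"] sum_chi1
  by (simp add: X_def)

lemma sum_C_fun_Y: "(\<Sum>j\<in>{0..<c}. \<Sum>n\<in>{0..<int q1}. C j n * f (Y j)) = 0"
proof -
  have "(\<Sum>n\<in>{0..<int q1}. C j n * f (Y j)) = (\<Sum>n\<in>{0..<int q1}. cnj (chi1 n)) * (cnj (chi2 j) * f (Y j))" for j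
    unfolding C_def sum_distrib_right by (rule sum.cong) (simp_all only: mult_ac)
  then show ?thesis by (simp add: sum_chi1)
qed

text \<open>Where the weight is nonzero both arguments are non-integers, so the Bernoulli function
  is the fractional part minus 1/2; elsewhere both summands are 0.\<close>

lemma sum_C_bernoulli:
  "(\<Sum>j\<in>{0..<c}. \<Sum>n\<in>{0..<int q1}. C j n * of_real ((X j n - 1/2) * (Y j - 1/2))) =
   (\<Sum>j\<in>{0..<c}. \<Sum>n\<in>{0..<int q1}. cnj (chi2 j) * cnj (chi1 n) *
       of_real (bernoulli_B1 (of_int j / of_int c)) *
       of_real (bernoulli_B1 (of_int n / of_nat q1 + of_int (a * j) / of_int c)))"
proof (intro sum.cong refl)
  fix j n assume "j \<in> {0..<c}"
  have B: "bernoulli_B1 (of_int m / of_int c) = of_int (m mod c) / of_int c - 1/2" if "m mod c \<noteq> 0" for m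
  proof -
    have "m = c * (m div c) + m mod c" by simp
    then have "real_of_int m = of_int c * of_int (m div c) + of_int (m mod c)"
      by (metis of_int_add of_int_mult)
    then have "real_of_int m / of_int c = of_int (m div c) + of_int (m mod c) / of_int c"
      using c by (simp add: field_simps)
    moreover have "of_int m / of_int c \<notin> (\<int> :: real set)"
    proof
      assume "of_int m / of_int c \<in> (\<int> :: real set)"
      then obtain k where "of_int m / of_int c = (of_int k :: real)" by (auto elim: Ints_cases)
      then have "real_of_int m = of_int (k * c)" using c by (simp add: field_simps)
      then have "m = k * c" by (simp only: of_int_eq_iff)
      then show False using that by simp
    qed
    ultimately show ?thesis
      using floor_divide_of_int_eq[of m c, where ?'a = real] by (simp add: bernoulli_B1_def)
  qed
  show "C j n * of_real ((X j n - 1/2) * (Y j - 1/2)) = cnj (chi2 j) * cnj (chi1 n) *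
       of_real (bernoulli_B1 (of_int j / of_int c)) *
       of_real (bernoulli_B1 (of_int n / of_nat q1 + of_int (a * j) / of_int c))"
  proof (cases "C j n = 0")
    case True
    then show ?thesis by (auto simp: C_def)
  next
    case False
    have "of_int n / of_nat q1 + of_int (a * j) / of_int c = (of_int (c' * n + a * j) / of_int c :: real)"
      using c'_nonzero q1 unfolding c_eq by (auto simp: field_simps)
    then show ?thesis
      using B[OF C_nonzero(1)[OF False]] B[OF C_nonzero(2)[OF False]]
      by (simp only: X_def Y_def C_def of_real_mult mult_ac)
  qed
qed

text \<open>Summing the reciprocity against \<open>C\<close> produces each Lambert series twice, by
  the symmetry under negation. The resulting factor 2 cancels that of 2 \<pi> i.\<close>

lemma eisenstein_f_difference_vertical:
  assumes t: "t > 0"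
  shows "\<tau> * (eisenstein_f chi1 chi2 (Complex (of_int a / of_int c) (t / of_int c)) -
      \<psi> * eisenstein_f chi1 chi2 (Complex (of_int (-d) / of_int c) ((1 / t) / of_int c))) =
    pi * \<i> * (\<Sum>j\<in>{0..<c}. \<Sum>n\<in>{0..<int q1}. C j n * of_real ((X j n - 1/2) * (Y j - 1/2)))"
proof -
  define T where "T x y l =
          ((exp_2pii (of_real (real l * x)) * bernoulli_kernel y (- 2 * pi * l * t)
          + exp_2pii (- of_real (real l * x)) * bernoulli_kernel (1 - y) (- 2 * pi * l * t))
          - (exp_2pii (- of_real (real l * y)) * bernoulli_kernel x (- 2 * pi * l / t)
          + exp_2pii (of_real (real l * y)) * bernoulli_kernel (1 - x) (- 2 * pi * l / t))) / of_nat l"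
    for x y and l :: nat
  obtain g h :: "real \<Rightarrow> complex" where gh:
    "\<And>x y. 0 < x \<Longrightarrow> x < 1 \<Longrightarrow> 0 < y \<Longrightarrow> y < 1 \<Longrightarrow>
      (\<lambda>N. \<Sum>l\<in>{1..N}. T x y l) \<longlonglongrightarrow> 2 * pi * \<i> * of_real ((x - 1/2) * (y - 1/2)) + g x + h y"
    using bernoulli_kernel_reciprocity[OF t] unfolding T_def by blast
  define f1 where "f1 l = (\<Sum>r\<in>{0..<c}. cnj (chi2 r) *
      (exp_2pii (of_int (int l * (r * a)) / of_int c) * bernoulli_kernel (of_int r / of_int c) (- 2 * pi * l * t)))"
    for l :: nat
  define f2 where "f2 l = (\<Sum>r\<in>{0..<c}. cnj (chi2 r) *
      (exp_2pii (of_int (int l * (r * - d)) / of_int c) * bernoulli_kernel (of_int r / of_int c) (- 2 * pi * l / t)))"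
    for l :: nat
  have termwise: "(\<Sum>j\<in>{0..<c}. \<Sum>n\<in>{0..<int q1}. C j n * T (X j n) (Y j) l) =
      2 * \<tau> * (chi1 (int l) / of_nat l * f1 l - \<psi> * (chi1 (int l) / of_nat l * f2 l))" for l
  proof -
    \<comment> \<open>Negating \<open>j\<close> and \<open>n\<close> exchanges the two halves of each Lambert series and, by parity, fixes \<open>C j n\<close>.\<close>
    define u v where "u = complex_of_real (- 2 * pi * l * t)" and "v = complex_of_real (- 2 * pi * l / t)"
    define E1 where "E1 j n = exp_2pii (of_real (real l * X j n)) * bernoulli_kernel (Y j) u" for j n
    define E2 where "E2 j n = exp_2pii (- of_real (real l * Y j)) * bernoulli_kernel (X j n) v" for j n
    have E1_minus: "E1 (-j) (-n) = exp_2pii (- of_real (real l * X j n)) * bernoulli_kernel (1 - Y j) u"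
      if "C j n \<noteq> 0" for j n
    proof -
      have "complex_of_real (real l * (1 - X j n)) = of_int (int l) + - of_real (real l * X j n)"
        by (simp add: algebra_simps)
      then have "exp_2pii (of_real (real l * (1 - X j n))) = exp_2pii (- of_real (real l * X j n))"
        using exp_2pii_of_int[of "int l"] by (simp only: exp_2pii_add) simp
      then show ?thesis by (simp add: E1_def C_nonzero_range[OF that])
    qed
    have E2_minus: "E2 (-j) (-n) = exp_2pii (of_real (real l * Y j)) * bernoulli_kernel (1 - X j n) v"
      if "C j n \<noteq> 0" for j n
    proof -
      have "- complex_of_real (real l * (1 - Y j)) = of_int (- int l) + of_real (real l * Y j)"
        by (simp add: algebra_simps)
      then have "exp_2pii (- of_real (real l * (1 - Y j))) = exp_2pii (of_real (real l * Y j))"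
        using exp_2pii_of_int[of "- int l"] by (simp only: exp_2pii_add) simp
      then show ?thesis by (simp add: E2_def C_nonzero_range[OF that])
    qed
    have "C j n * T (X j n) (Y j) l = (C j n * E1 j n + C j n * E1 (-j) (-n) -
        (C j n * E2 j n + C j n * E2 (-j) (-n))) / of_nat l" for j n
    proof (cases "C j n = 0")
      case False
      show ?thesis
        unfolding E1_minus[OF False] E2_minus[OF False]
        unfolding T_def E1_def E2_def u_def v_def
        by (simp only: times_divide_eq_right right_diff_distrib distrib_left)
    qed simp
    then have "(\<Sum>j\<in>{0..<c}. \<Sum>n\<in>{0..<int q1}. C j n * T (X j n) (Y j) l) =
      ((\<Sum>j\<in>{0..<c}. \<Sum>n\<in>{0..<int q1}. C j n * E1 j n) + (\<Sum>j\<in>{0..<c}. \<Sum>n\<in>{0..<int q1}. C j n * E1 (-j) (-n)) -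
      ((\<Sum>j\<in>{0..<c}. \<Sum>n\<in>{0..<int q1}. C j n * E2 j n) + (\<Sum>j\<in>{0..<c}. \<Sum>n\<in>{0..<int q1}. C j n * E2 (-j) (-n)))) / of_nat l"
      by (simp only: sum_divide_distrib[symmetric] sum_subtractf sum.distrib)
    also have "(\<Sum>j\<in>{0..<c}. \<Sum>n\<in>{0..<int q1}. C j n * E1 (-j) (-n)) = (\<Sum>j\<in>{0..<c}. \<Sum>n\<in>{0..<int q1}. C j n * E1 j n)"
      by (rule sum_C_minus) (simp_all only: E1_def X_periodic Y_periodic)
    also have "(\<Sum>j\<in>{0..<c}. \<Sum>n\<in>{0..<int q1}. C j n * E2 (-j) (-n)) = (\<Sum>j\<in>{0..<c}. \<Sum>n\<in>{0..<int q1}. C j n * E2 j n)"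
      by (rule sum_C_minus) (simp_all only: E2_def X_periodic Y_periodic)
    also have "(\<Sum>j\<in>{0..<c}. \<Sum>n\<in>{0..<int q1}. C j n * E1 j n) = \<tau> * chi1 (int l) * f1 l"
      unfolding E1_def sum_C_X[of l "\<lambda>y. bernoulli_kernel y u"] by (simp only: f1_def u_def)
    also have "(\<Sum>j\<in>{0..<c}. \<Sum>n\<in>{0..<int q1}. C j n * E2 j n) = \<tau> * \<psi> * chi1 (int l) * f2 l"
      unfolding E2_def sum_C_Y[of l "\<lambda>x. bernoulli_kernel x v"] by (simp only: f2_def v_def)
    finally show ?thesis by (simp add: diff_divide_distrib add_divide_distrib algebra_simps)
  qed
  \<comment> \<open>The ranges of j and n are finite, so the limit is taken termwise; a nonzero
    weight puts \<open>X\<close> and \<open>Y\<close> strictly between 0 and 1.\<close>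
  have "(\<lambda>N. \<Sum>j\<in>{0..<c}. \<Sum>n\<in>{0..<int q1}. C j n * (\<Sum>l\<in>{1..N}. T (X j n) (Y j) l)) \<longlonglongrightarrow>
      (\<Sum>j\<in>{0..<c}. \<Sum>n\<in>{0..<int q1}. C j n *
        (2 * pi * \<i> * of_real ((X j n - 1/2) * (Y j - 1/2)) + g (X j n) + h (Y j)))"
  proof (intro tendsto_sum)
    fix j n
    show "(\<lambda>N. C j n * (\<Sum>l\<in>{1..N}. T (X j n) (Y j) l)) \<longlonglongrightarrow>
      C j n * (2 * pi * \<i> * of_real ((X j n - 1/2) * (Y j - 1/2)) + g (X j n) + h (Y j))"
    proof (cases "C j n = 0")
      case False
      show ?thesis
        by (rule tendsto_mult_left[OF gh[OF C_nonzero_range(1-4)[OF False]]])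
    qed simp
  qed
  also have "(\<Sum>j\<in>{0..<c}. \<Sum>n\<in>{0..<int q1}. C j n *
        (2 * pi * \<i> * of_real ((X j n - 1/2) * (Y j - 1/2)) + g (X j n) + h (Y j))) =
      2 * pi * \<i> * (\<Sum>j\<in>{0..<c}. \<Sum>n\<in>{0..<int q1}. C j n * of_real ((X j n - 1/2) * (Y j - 1/2)))"
    (is "?L = _ * ?R")
  proof -
    have "?L = (\<Sum>j\<in>{0..<c}. \<Sum>n\<in>{0..<int q1}. 2 * pi * \<i> * (C j n * of_real ((X j n - 1/2) * (Y j - 1/2)))
      + C j n * g (X j n) + C j n * h (Y j))"
      by (intro sum.cong refl) (simp only: ring_distribs mult_ac)
    also have "\<dots> = 2 * pi * \<i> * ?R"
      unfolding sum.distrib sum_C_fun_X sum_C_fun_Y sum_distrib_left[symmetric] by simp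
    finally show ?thesis .
  qed
  also have "(\<lambda>N. \<Sum>j\<in>{0..<c}. \<Sum>n\<in>{0..<int q1}. C j n * (\<Sum>l\<in>{1..N}. T (X j n) (Y j) l)) =
     (\<lambda>N. 2 * \<tau> * ((\<Sum>l\<in>{1..N}. chi1 (int l) / of_nat l * f1 l) - \<psi> * (\<Sum>l\<in>{1..N}. chi1 (int l) / of_nat l * f2 l)))"
  proof
    fix N
    have "(\<Sum>j\<in>{0..<c}. \<Sum>n\<in>{0..<int q1}. C j n * (\<Sum>l\<in>{1..N}. T (X j n) (Y j) l)) =
        (\<Sum>j\<in>{0..<c}. \<Sum>l\<in>{1..N}. \<Sum>n\<in>{0..<int q1}. C j n * T (X j n) (Y j) l)"
      unfolding sum_distrib_left by (intro sum.cong refl sum.swap)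
    also have "\<dots> = (\<Sum>l\<in>{1..N}. \<Sum>j\<in>{0..<c}. \<Sum>n\<in>{0..<int q1}. C j n * T (X j n) (Y j) l)"
      by (rule sum.swap)
    also have "\<dots> = (\<Sum>l\<in>{1..N}. 2 * \<tau> * (chi1 (int l) / of_nat l * f1 l - \<psi> * (chi1 (int l) / of_nat l * f2 l)))"
      by (simp only: termwise)
    also have "\<dots> = 2 * \<tau> * ((\<Sum>l\<in>{1..N}. chi1 (int l) / of_nat l * f1 l) - \<psi> * (\<Sum>l\<in>{1..N}. chi1 (int l) / of_nat l * f2 l))"
      by (simp only: sum_distrib_left[symmetric] sum_subtractf)
    finally show "(\<Sum>j\<in>{0..<c}. \<Sum>n\<in>{0..<int q1}. C j n * (\<Sum>l\<in>{1..N}. T (X j n) (Y j) l)) = \<dots>" .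
  qed
  finally have lim: "(\<lambda>N. 2 * \<tau> * ((\<Sum>l\<in>{1..N}. chi1 (int l) / of_nat l * f1 l) - \<psi> * (\<Sum>l\<in>{1..N}. chi1 (int l) / of_nat l * f2 l)))
    \<longlonglongrightarrow> 2 * pi * \<i> * (\<Sum>j\<in>{0..<c}. \<Sum>n\<in>{0..<int q1}. C j n * of_real ((X j n - 1/2) * (Y j - 1/2)))" .
  have l1: "(\<lambda>N. \<Sum>l\<in>{1..N}. chi1 (int l) / of_nat l * f1 l)
      \<longlonglongrightarrow> eisenstein_f chi1 chi2 (Complex (of_int a / of_int c) (t / of_int c))"
    unfolding f1_def
    by (rule eisenstein_f_cusp_expansion[OF chi1.dirichlet_axioms chi2.dirichlet_axioms q2 c q2_dvd_c t])
  have "1 / t > 0" using t by simp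
  from eisenstein_f_cusp_expansion[OF chi1.dirichlet_axioms chi2.dirichlet_axioms q2 c q2_dvd_c this, of "-d"]
  have l2: "(\<lambda>N. \<Sum>l\<in>{1..N}. chi1 (int l) / of_nat l * f2 l)
      \<longlonglongrightarrow> eisenstein_f chi1 chi2 (Complex (of_int (-d) / of_int c) ((1 / t) / of_int c))"
    unfolding f2_def by (simp only: times_divide_eq_right mult_1_right)
  have "2 * pi * \<i> * (\<Sum>j\<in>{0..<c}. \<Sum>n\<in>{0..<int q1}. C j n * of_real ((X j n - 1/2) * (Y j - 1/2))) =
      2 * \<tau> * (eisenstein_f chi1 chi2 (Complex (of_int a / of_int c) (t / of_int c)) -
      \<psi> * eisenstein_f chi1 chi2 (Complex (of_int (-d) / of_int c) ((1 / t) / of_int c)))"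
    by (rule LIMSEQ_unique[OF lim]) (intro tendsto_intros l1 l2)
  then show ?thesis by (simp only: mult.assoc mult_left_cancel zero_neq_numeral[symmetric] simp_thms) simp
qed

end

section \<open>From a vertical half-line to the whole upper half-plane\<close>

lemma moebius_action_eq:
  assumes "\<gamma> = vector [vector [a, b], vector [c, d]]" "a * d - b * c = 1" "c > 0" "Im z > 0"
  shows "moebius_action \<gamma> z = of_int a / of_int c - 1 / (of_int c * (of_int c * z + of_int d))"
    and "of_int c * z + of_int d \<noteq> 0"
    and "Im (moebius_action \<gamma> z) > 0"
proof -
  define w where "w = of_int c * z + of_int d"
  have Im_w: "Im w > 0" using assms(3,4) by (simp add: w_def)
  then have w: "w \<noteq> 0" by auto
  then show "of_int c * z + of_int d \<noteq> 0" by (simp add: w_def)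
  have "a * d - 1 = b * c" using assms(2) by simp
  then have ad: "(of_int a * of_int d - 1 :: complex) = of_int b * of_int c"
    by (metis of_int_1 of_int_diff of_int_mult)
  have "of_int a / of_int c - 1 / (of_int c * w) = (of_int a * w - 1) / (of_int c * w)"
    using w assms(3) by (simp add: field_simps)
  also have "of_int a * w - 1 = of_int c * (of_int a * z + of_int b)"
    using ad by (simp add: w_def algebra_simps)
  also have "of_int c * (of_int a * z + of_int b) / (of_int c * w) = moebius_action \<gamma> z"
    using assms(1,3) by (simp add: moebius_action_def w_def)
  finally have eq: "moebius_action \<gamma> z = of_int a / of_int c - 1 / (of_int c * w)" ..
  then show "moebius_action \<gamma> z = of_int a / of_int c - 1 / (of_int c * (of_int c * z + of_int d))"
    by (simp add: w_def)
  have "Im (1 / (of_int c * w)) < 0"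
  proof -
    have "1 / (of_int c * w) = inverse w / of_real (of_int c)"
      by (simp add: field_simps)
    then show ?thesis
      using Im_w assms(3) by (simp add: Im_divide_of_real divide_less_0_iff w sum_power2_gt_zero_iff)
  qed
  then show "Im (moebius_action \<gamma> z) > 0"
    using eq by simp
qed

text \<open>The half-line is connected with more than one point, so its points are limit points and
  the identity theorem applies.\<close>

lemma constant_on_upper_half_plane:
  assumes "F holomorphic_on upper_half_plane" "\<And>s. s > 0 \<Longrightarrow> F (Complex r s) = w" "Im z > 0"
  shows "F z = w"
proof -
  define U where "U = (\<lambda>s. Complex r s) ` {0<..}"
  have "F z - w = 0"
  proof (rule analytic_continuation[of "\<lambda>z. F z - w" upper_half_plane U "Complex r 1"])
    show "(\<lambda>z. F z - w) holomorphic_on upper_half_plane"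
      by (intro holomorphic_intros assms)
    show "open upper_half_plane" "connected upper_half_plane"
      unfolding upper_half_plane_def
      by (simp_all add: open_halfspace_Im_gt convex_connected convex_halfspace_Im_gt)
    show "U \<subseteq> upper_half_plane" by (auto simp: U_def upper_half_plane_def)
    show "Complex r 1 \<in> upper_half_plane" by (simp add: upper_half_plane_def)
    have "connected U"
      unfolding U_def Complex_eq by (intro connected_continuous_image continuous_intros) auto
    moreover have "Complex r 1 \<in> U" "U \<noteq> {Complex r 1}"
    proof -
      show "Complex r 1 \<in> U" by (simp add: U_def)
      have "Complex r 2 \<in> U" by (simp add: U_def)
      then show "U \<noteq> {Complex r 1}" by auto
    qed
    ultimately show "Complex r 1 islimpt U" by (intro connected_imp_perfect) auto
    show "F u - w = 0" if "u \<in> U" for u using that assms(2) by (auto simp: U_def)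
    show "z \<in> upper_half_plane" using assms(3) by (simp add: upper_half_plane_def)
  qed
  then show ?thesis by simp
qed

theorem theorem1p2:
  fixes chi1 chi2 :: "int \<Rightarrow> complex" and q1 q2 :: nat
    and a b c d :: int and \<gamma> :: "int^2^2"
  assumes "primitive_character q1 chi1" and "primitive_character q2 chi2"
    and "q1 > 1" and "q2 > 1"
    and "chi1 (-1) * chi2 (-1) = 1"
    and "\<gamma> = vector [vector [a, b], vector [c, d]]"
    and "\<gamma> \<in> Gamma0 (q1 * q2)"
    and "c \<ge> 1"
  shows "dedekind_sum q1 chi1 chi2 \<gamma> =
    (\<Sum>j\<in>{0..<c}. \<Sum>n\<in>{0..<int q1}.
       cnj (chi2 j) * cnj (chi1 n) *
       of_real (bernoulli_B1 (of_int j / of_int c)) *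
       of_real (bernoulli_B1 (of_int n / of_nat q1 + of_int (a * j) / of_int c)))"
    (is "_ = ?R")
proof -
  have entries: "\<gamma> $ 1 $ 1 = a" "\<gamma> $ 1 $ 2 = b" "\<gamma> $ 2 $ 1 = c" "\<gamma> $ 2 $ 2 = d"
    using assms(6) by simp_all
  have det: "a * d - b * c = 1" and "int (q1 * q2) dvd c"
    using assms(7) by (simp_all add: Gamma0_def det_2 entries)
  then obtain k where "c = int (q1 * q2) * k" by (auto elim: dvdE)
  then have k: "c = int q1 * (int q2 * k)" by simp
  have c: "c > 0" using assms(8) by simp
  interpret dedekind_data q1 q2 chi1 chi2 a b c d "int q2 * k"
    using assms det c k by unfold_locales (auto simp: primitive_character_def)
  define F where "F z = eisenstein_f chi1 chi2 (moebius_action \<gamma> z) - \<psi> * eisenstein_f chi1 chi2 z" for z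
  have psi: "nebentypus chi1 chi2 \<gamma> = \<psi>"
    by (simp add: nebentypus_def entries \<psi>_def)
  have vertical: "\<tau> * F (Complex (of_int (-d) / of_int c) s) = pi * \<i> * ?R" if s: "s > 0" for s
  proof -
    \<comment> \<open>On this line c z + d = i c s, so the image of z is a / c + i / (c c s). The
      choice of t makes its imaginary part t / c, and then s = (1 / t) / c.\<close>
    define t where "t = 1 / (of_int c * s)"
    have t: "t > 0" using s c by (simp add: t_def)
    have s_eq: "s = (1 / t) / of_int c" using c by (simp add: t_def)
    have z: "of_int c * Complex (of_int (-d) / of_int c) s + of_int d = \<i> * of_real (of_int c * s)"
      using c by (simp add: complex_eq_iff)
    have "moebius_action \<gamma> (Complex (of_int (-d) / of_int c) s) = Complex (of_int a / of_int c) (t / of_int c)"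
      using moebius_action_eq(1)[OF assms(6) det c, of "Complex (of_int (-d) / of_int c) s"] s c
      unfolding z by (simp add: complex_eq_iff t_def Re_divide Im_divide power2_eq_square)
    then show ?thesis
      using eisenstein_f_difference_vertical[OF t] unfolding F_def sum_C_bernoulli s_eq[symmetric] by simp
  qed
  show ?thesis
  \<comment> \<open>If \<tau> = 0, the Dedekind sum vanishes through its Gauss sum factor, and
    \<open>vertical\<close> forces the right-hand side to vanish as well. Otherwise \<tau> can be
    divided out.\<close>
  proof (cases "\<tau> = 0")
    case True
    then have "?R = 0" using vertical[of 1] by simp
    then show ?thesis using True by (simp add: dedekind_sum_def \<tau>_def)
  next
    case False
    have "F holomorphic_on upper_half_plane"
    proof -
      note holo = eisenstein_f_holomorphic[OF chi1.dirichlet_axioms chi2.dirichlet_axioms]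
      have "(\<lambda>z. of_int a / of_int c - 1 / (of_int c * (of_int c * z + of_int d))) holomorphic_on upper_half_plane"
        using c moebius_action_eq(2)[OF assms(6) det c]
        by (intro holomorphic_intros) (auto simp: upper_half_plane_def)
      then have "moebius_action \<gamma> holomorphic_on upper_half_plane"
        by (rule holomorphic_transform)
           (simp add: upper_half_plane_def moebius_action_eq(1)[OF assms(6) det c])
      then have "(\<lambda>z. eisenstein_f chi1 chi2 (moebius_action \<gamma> z)) holomorphic_on upper_half_plane"
        using holomorphic_on_compose_gen[OF _ holo, of "moebius_action \<gamma>" upper_half_plane]
          moebius_action_eq(3)[OF assms(6) det c]
        by (auto simp: o_def upper_half_plane_def)
      then show ?thesis unfolding F_def by (intro holomorphic_intros holo)
    qed
    moreover have "F (Complex (of_int (-d) / of_int c) s) = pi * \<i> * ?R / \<tau>" if "s > 0" for s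
      unfolding vertical[OF that, symmetric] using False by (rule nonzero_mult_div_cancel_left[symmetric])
    ultimately have F_eq: "F z = pi * \<i> * ?R / \<tau>" if "Im z > 0" for z
      using that by (rule constant_on_upper_half_plane)
    have "dedekind_phi chi1 chi2 \<gamma> = pi * \<i> * ?R / \<tau>"
      unfolding dedekind_phi_def psi F_def[symmetric]
    proof (rule the_equality)
      show "\<forall>z\<in>upper_half_plane. F z = pi * \<i> * ?R / \<tau>"
        using F_eq by (simp add: upper_half_plane_def)
      \<comment> \<open>The definite description also requires uniqueness, which evaluation at the
        single point \<i> gives.\<close>
      fix w assume "\<forall>z\<in>upper_half_plane. F z = w"
      then have "F \<i> = w" by (simp add: upper_half_plane_def)
      then show "w = pi * \<i> * ?R / \<tau>" using F_eq[of \<i>] by simp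
    qed
    then show ?thesis
      using False by (simp add: dedekind_sum_def \<tau>_def)
  qed
qed

end
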